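(* Assume the setting described in the context. Then for each $i\in\{1,\dots,d\}$, $$\mu(F_i(a/b))<4^{Hd^2}k^{5d^2}.$$
   Context: Let $k,d\ge2$ be integers. Let $a_{i,j}(x)\in\mathbb{Z}[x]$ for $1\le i,j\le d$, and let $B(x)\in\mathbb{Z}[x]$ with $B(0)\neq0$. Let $H=\max_{i,j}\{\deg a_{i,j}(x),\deg B(x)\}$. Let $\mathbf{A}(x)$ be the $d\times d$ matrix with $(i,j)$-entry $a_{i,j}(x)/B(x)$, and assume $\det\mathbf{A}(x)$ is a nonzero rational function. Let $F_1(x)=1,F_2(x),\dots,F_d(x)\in\mathbb{Z}[[x]]$ be linearly independent over $\mathbb{Q}(x)$ and satisfy $[F_1(x),\dots,F_d(x)]^T=\mathbf{A}(x)[F_1(x^k),\dots,F_d(x^k)]^T$. Let $a,b\in\mathbb{Z}$ with $a\neq0$, $b\ge2$, $\rho:=\log|a|/\log b\in[0,1/(d+1))$, such that $|a/b|$ is in the radius of convergence of each $F_i$ and $B((a/b)^{k^n})\neq0$ for all $n\ge0$. The irrationality exponent $\mu(\xi)$ of a real $\xi$ is the supremum of the real $\mu$ such that $0<|\xi-p/q|<q^{-\mu}$ has infinitely many solutions $(p,q)\in\mathbb{Z}\times\mathbb{N}$. *)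

theory Defs
  imports
    "HOL-Analysis.FPS_Convergence"
    "HOL-Computational_Algebra.Computational_Algebra"
    "Jordan_Normal_Form.Determinant"
begin

text \<open>
  The field \<open>\<rat>(x)\<close> is \<^typ>\<open>rat poly fract\<close>. It is embedded into the field \<open>\<rat>((x))\<close> of formal
  Laurent series, which also contains \<open>\<int>[[x]]\<close>; products of rational functions with power
  series are taken there.
\<close>

definition ratfun_to_fls :: "rat poly fract \<Rightarrow> rat fls" where
  "ratfun_to_fls r =
     (THE z. \<exists>p q. q \<noteq> 0 \<and> r = Fract p q \<and>
               z = fps_to_fls (fps_of_poly p) / fps_to_fls (fps_of_poly q))"

lemma ratfun_to_fls_Fract:
  assumes "q \<noteq> 0"
  shows "ratfun_to_fls (Fract p q) =
           fps_to_fls (fps_of_poly p) / fps_to_fls (fps_of_poly q)"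
  unfolding ratfun_to_fls_def
proof (rule the_equality)
  show "\<exists>p' q'. q' \<noteq> 0 \<and> Fract p q = Fract p' q' \<and>
          fps_to_fls (fps_of_poly p) / fps_to_fls (fps_of_poly q) =
          fps_to_fls (fps_of_poly p') / fps_to_fls (fps_of_poly q')"
    using assms by blast
next
  fix z :: "rat fls"
  assume "\<exists>p' q'. q' \<noteq> 0 \<and> Fract p q = Fract p' q' \<and>
            z = fps_to_fls (fps_of_poly p') / fps_to_fls (fps_of_poly q')"
  then obtain p' q' where "q' \<noteq> 0" "Fract p q = Fract p' q'"
    and z: "z = fps_to_fls (fps_of_poly p') / fps_to_fls (fps_of_poly q')"
    by blast
  then have "p' * q = p * q'"
    using assms by (simp add: eq_fract)
  then have "fps_to_fls (fps_of_poly p') * fps_to_fls (fps_of_poly q) =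
             fps_to_fls (fps_of_poly p) * fps_to_fls (fps_of_poly q')"
    by (metis fls_times_fps_to_fls fps_of_poly_mult)
  then show "z = fps_to_fls (fps_of_poly p) / fps_to_fls (fps_of_poly q)"
    using \<open>q' \<noteq> 0\<close> assms by (simp add: z frac_eq_eq)
qed

definition of_int_fps :: "int fps \<Rightarrow> 'a :: ring_1 fps" where
  "of_int_fps f = Abs_fps (\<lambda>n. of_int (fps_nth f n))"

abbreviation zseries_to_fls :: "int fps \<Rightarrow> rat fls" where
  "zseries_to_fls f \<equiv> fps_to_fls (of_int_fps f)"

definition lin_indep_over_ratfun :: "nat \<Rightarrow> (nat \<Rightarrow> int fps) \<Rightarrow> bool" where
  "lin_indep_over_ratfun d F \<longleftrightarrow>
     (\<forall>c :: nat \<Rightarrow> rat poly fract.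
        (\<Sum>i<d. ratfun_to_fls (c i) * zseries_to_fls (F i)) = 0 \<longrightarrow> (\<forall>i<d. c i = 0))"

definition mahler_matrix ::
  "nat \<Rightarrow> (nat \<Rightarrow> nat \<Rightarrow> int poly) \<Rightarrow> int poly \<Rightarrow> rat poly fract mat" where
  "mahler_matrix d A B =
     mat d d (\<lambda>(i, j). Fract (map_poly of_int (A i j)) (map_poly of_int B))"

definition mahler_system ::
  "nat \<Rightarrow> nat \<Rightarrow> rat poly fract mat \<Rightarrow> (nat \<Rightarrow> int fps) \<Rightarrow> bool" where
  "mahler_system k d M F \<longleftrightarrow>
     vec d (\<lambda>i. zseries_to_fls (F i)) =
       map_mat ratfun_to_fls M *\<^sub>v
         vec d (\<lambda>i. zseries_to_fls (fps_compose (F i) (fps_X ^ k)))"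

text \<open>
  In \<^term>\<open>mahler_height d A B\<close> a zero entry contributes degree \<open>0\<close> instead of \<open>-\<infinity>\<close>; this does not
  affect the maximum when \<open>B \<noteq> 0\<close>.
\<close>

definition mahler_height :: "nat \<Rightarrow> (nat \<Rightarrow> nat \<Rightarrow> int poly) \<Rightarrow> int poly \<Rightarrow> nat" where
  "mahler_height d A B =
     Max (insert (degree B) {degree (A i j) | i j. i < d \<and> j < d})"

text \<open>
  The supremum is taken in the extended reals, so that Liouville numbers have exponent \<open>\<infinity>\<close>.
  The pairs \<open>(p, q)\<close> need not be coprime.
\<close>

definition irrationality_exponent :: "real \<Rightarrow> ereal" where
  "irrationality_exponent \<xi> =
     Sup (ereal ` {\<mu> :: real. infinite {(p :: int, q :: nat). 0 < q \<and>
            0 < \<bar>\<xi> - of_int p / of_nat q\<bar> \<and>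
            \<bar>\<xi> - of_int p / of_nat q\<bar> < of_nat q powr (- \<mu>)}})"

end

(*
  Take polynomials Q, P_j of degree at most N with Q F_j - P_j = O(x^M) (Siegel-type linear algebra)
  and push them through the functional equation: W_0 = P, W_(n+1)(x) = (a_ij(x)) W_n(x^k),
  and Q_0 = Q, Q_(n+1)(x) = B(x) Q_n(x^k). Both have degree at most E k^n with E = N + H, and
  W_n - Q_n F = O(x^(M k^n)). With N = (d^2 - 1)(H + 2) and M = d (d + 1) (H + 2), the hypothesis
  |a|^(d+1) < b makes b^(E k^n) (W_n - Q_n F)(a/b) tend to 0 like b^(-2 k^n) up to a factor C^n, so these
  integers approximate F_i(a/b) well. The first d vectors W_0, ..., W_(d-1) are linearly independent
  over Q(x), because otherwise a fixed linear form would kill all W_n and hence F; evaluated at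
  (a/b)^(k^n) this shows that among d consecutive approximations at least one differs from any given
  p/q, which bounds the exponent by 1 + (E + 1) k^d.
*)

theory Submission
  imports Defs "Jordan_Normal_Form.Char_Poly"
begin

section \<open>Simultaneous approximation of power series by polynomials\<close>

text \<open>The constants come from balancing one inequality. Write rho for log|a| / log b. In base
  b, the error b^(E k^n) |a/b|^(M k^n) has exponent (E - M + M rho) k^n, and this must be at most -2
  k^n. The count of unknowns against equations is matched by M - N = M/d, so the construction alone
  would tolerate rho up to 1/d. The hypothesis rho < 1/(d+1) leaves a margin of M/d - M/(d+1) = M/(d
  (d+1)), and M = d (d+1) (H+2) makes this margin H + 2. Of it, H pays for the degree growth under
  iteration; of the two remaining powers of b^(k^n), one absorbs the factor C^n and the other beats
  q.

  The obstacle is that an approximation may coincide with p/q, while the matrices A((a/b)^(k^m)) may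
  be singular. Independence is therefore expressed by one fixed polynomial determinant, whose
  finitely many zeros are eventually avoided by (a/b)^(k^n), and only values of linear forms on F
  are carried back to a/b.\<close>

lemma det_eq_0_iff_kernel:
  fixes c :: "nat \<Rightarrow> nat \<Rightarrow> 'a :: idom"
  shows "det (mat n n (\<lambda>(i, j). c i j)) = 0 \<longleftrightarrow>
    (\<exists>v. (\<exists>j<n. v j \<noteq> 0) \<and> (\<forall>i<n. (\<Sum>j<n. c i j * v j) = 0))"
proof -
  let ?A = "mat n n (\<lambda>(i, j). c i j)"
  have A: "?A \<in> carrier_mat n n" by simp
  have mv: "?A *\<^sub>v w = vec n (\<lambda>i. \<Sum>j<n. c i j * vec_index w j)" if "w \<in> carrier_vec n" for w
    using that by (intro eq_vecI) (auto simp: scalar_prod_def atLeast0LessThan)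
  show ?thesis
    unfolding det_0_iff_vec_prod_zero[OF A]
  proof
    assume "\<exists>v. v \<in> carrier_vec n \<and> v \<noteq> 0\<^sub>v n \<and> ?A *\<^sub>v v = 0\<^sub>v n"
    then obtain w where w: "w \<in> carrier_vec n" "w \<noteq> 0\<^sub>v n" "?A *\<^sub>v w = 0\<^sub>v n" by blast
    have "\<exists>j<n. vec_index w j \<noteq> 0"
    proof (rule ccontr)
      assume "\<not> ?thesis"
      then have "w = 0\<^sub>v n" using w(1) by (intro eq_vecI) auto
      with w(2) show False ..
    qed
    moreover have "(\<Sum>j<n. c i j * vec_index w j) = 0" if "i < n" for i
    proof -
      have "vec_index (vec n (\<lambda>i. \<Sum>j<n. c i j * vec_index w j)) i = 0"
        unfolding mv[OF w(1), symmetric] w(3) using that by simp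
      then show ?thesis using that by simp
    qed
    ultimately show "\<exists>v. (\<exists>j<n. v j \<noteq> 0) \<and> (\<forall>i<n. (\<Sum>j<n. c i j * v j) = 0)"
      by (intro exI[of _ "\<lambda>j. vec_index w j"]) auto
  next
    assume "\<exists>v. (\<exists>j<n. v j \<noteq> 0) \<and> (\<forall>i<n. (\<Sum>j<n. c i j * v j) = 0)"
    then obtain v j where v: "j < n" "v j \<noteq> 0" "\<forall>i<n. (\<Sum>j<n. c i j * v j) = 0" by blast
    have "vec n v \<noteq> 0\<^sub>v n" using v(1,2) by (metis index_vec index_zero_vec(1))
    moreover have "?A *\<^sub>v vec n v = 0\<^sub>v n"
      using v(3) by (subst mv) (auto intro!: eq_vecI)
    ultimately show "\<exists>v. v \<in> carrier_vec n \<and> v \<noteq> 0\<^sub>v n \<and> ?A *\<^sub>v v = 0\<^sub>v n"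
      by (intro exI[of _ "vec n v"]) auto
  qed
qed

lemma det_eq_0_iff_left_kernel:
  fixes c :: "nat \<Rightarrow> nat \<Rightarrow> 'a :: idom"
  shows "det (mat n n (\<lambda>(i, j). c i j)) = 0 \<longleftrightarrow>
    (\<exists>v. (\<exists>i<n. v i \<noteq> 0) \<and> (\<forall>j<n. (\<Sum>i<n. v i * c i j) = 0))"
proof -
  have "transpose_mat (mat n n (\<lambda>(i, j). c i j)) = mat n n (\<lambda>(i, j). c j i)"
    by (intro eq_matI) auto
  then have "det (mat n n (\<lambda>(i, j). c i j)) = det (mat n n (\<lambda>(i, j). c j i))"
    by (metis det_transpose mat_carrier)
  then show ?thesis
    by (simp add: det_eq_0_iff_kernel mult.commute)
qed

text \<open>Zero rows pad the system to a square one. Row \<open>m\<close> is zero because m < n, so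
  a unit vector lies in the left kernel and the determinant vanishes. The kernel criterion holds
  over every integral domain, so the solution is integral at once.\<close>

lemma int_homogeneous_system:
  fixes c :: "nat \<Rightarrow> nat \<Rightarrow> int"
  assumes "m < n"
  obtains v where "\<exists>j<n. v j \<noteq> 0" "\<And>i. i < m \<Longrightarrow> (\<Sum>j<n. c i j * v j) = 0"
proof -
  let ?c = "\<lambda>i j. if i < m then c i j else 0"
  have "\<exists>i<n. (if i = m then 1 else 0 :: int) \<noteq> 0" using assms by auto
  moreover have "\<forall>j<n. (\<Sum>i<n. (if i = m then 1 else 0) * ?c i j) = 0"
    by (auto intro!: sum.neutral)
  ultimately have "det (mat n n (\<lambda>(i, j). ?c i j)) = 0"
    unfolding det_eq_0_iff_left_kernel
    by (intro exI[of _ "\<lambda>i. if i = m then 1 else 0"] conjI)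
  then obtain v where v: "\<exists>j<n. v j \<noteq> 0" "\<forall>i<n. (\<Sum>j<n. ?c i j * v j) = 0"
    unfolding det_eq_0_iff_kernel by blast
  have "(\<Sum>j<n. c i j * v j) = 0" if "i < m" for i
    using v(2)[rule_format, of i] that assms by simp
  with v(1) that show ?thesis by blast
qed

text \<open>Orders of vanishing of remainders are expressed by divisibility, because a remainder may
  be zero and \<open>subdegree 0 = 0\<close>.\<close>

lemma fps_X_power_dvdI:
  fixes f :: "'a :: comm_ring_1 fps"
  assumes "\<And>i. i < n \<Longrightarrow> fps_nth f i = 0"
  shows "fps_X ^ n dvd f"
proof
  show "f = fps_X ^ n * fps_shift n f"
    using assms by (intro fps_ext) (auto simp: fps_X_power_mult_nth)
qed

text \<open>The unknowns are the \<open>N + 1\<close> coefficients of \<open>Q\<close>; the equations are the vanishing of the coefficients of index \<open>N + 1, \<dots>, N + u\<close> of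
  \<open>Q F\<^sub>j\<close> for \<open>0 < j < d\<close>; \<open>F\<^sub>0 = 1\<close> imposes nothing.\<close>

lemma pade_approximation:
  fixes F :: "nat \<Rightarrow> int fps"
  assumes "F 0 = 1" and "(d - 1) * u \<le> N"
  obtains Q P where "Q \<noteq> 0" "degree Q \<le> N" "\<And>j. degree (P j) \<le> N"
    "\<And>j. j < d \<Longrightarrow> fps_X ^ (N + 1 + u) dvd fps_of_poly (P j) - fps_of_poly Q * F j"
proof -
  \<comment> \<open>Row i encodes a pair: \<open>Suc (i div u)\<close> is the index of the series,
    which skips \<open>F 0\<close>, and \<open>i mod u\<close> is the offset beyond
    \<open>N + 1\<close>.\<close>
  define c where "c i l = fps_nth (fps_X ^ l * F (Suc (i div u))) (N + 1 + i mod u)" for i l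
  obtain v where v: "\<exists>l<N+1. v l \<noteq> 0" "\<And>i. i < (d - 1) * u \<Longrightarrow> (\<Sum>l<N+1. c i l * v l) = 0"
    using int_homogeneous_system[of "(d - 1) * u" "N + 1" c] assms(2) by auto
  define Q where "Q = (\<Sum>l<N+1. monom (v l) l)"
  have cQ: "coeff Q l = (if l < N + 1 then v l else 0)" for l
    by (auto simp: Q_def coeff_sum)
  \<comment> \<open>Truncation of Q F_j at degree N: the coefficients up to index N then cancel for
    free.\<close>
  define P where "P j = (\<Sum>l<N+1. monom (fps_nth (fps_of_poly Q * F j) l) l)" for j
  have cP: "coeff (P j) n = (if n < N + 1 then fps_nth (fps_of_poly Q * F j) n else 0)" for j n
    by (auto simp: P_def coeff_sum)
  have dQ: "degree Q \<le> N" by (rule degree_le) (auto simp: cQ)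
  show ?thesis
  proof (rule that[of Q P])
    show "Q \<noteq> 0" using v(1) cQ by (metis coeff_0)
    show "degree Q \<le> N" by fact
    show "degree (P j) \<le> N" for j by (rule degree_le) (auto simp: cP)
    fix j assume j: "j < d"
    have fQ: "fps_of_poly Q = (\<Sum>l<N+1. fps_const (v l) * fps_X ^ l)"
      by (simp only: Q_def fps_of_poly_sum fps_of_poly_monom)
    show "fps_X ^ (N + 1 + u) dvd fps_of_poly (P j) - fps_of_poly Q * F j"
    proof (rule fps_X_power_dvdI)
      fix n assume n: "n < N + 1 + u"
      show "fps_nth (fps_of_poly (P j) - fps_of_poly Q * F j) n = 0"
      proof (cases "n \<le> N")
        case True
        then show ?thesis by (simp add: cP)
      next
        case False
        have "fps_nth (fps_of_poly Q * F j) n = 0"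
        proof (cases "j = 0")
          case True
          then show ?thesis using False assms(1) by (simp add: cQ)
        next
          case j0: False
          define i where "i = (j - 1) * u + (n - (N + 1))"
          have lt: "n - (N + 1) < u" using n False by linarith
          have i1: "i div u = j - 1" "i mod u = n - (N + 1)"
            using lt by (simp_all add: i_def)
          have "i < (j - 1) * u + u" using lt by (simp add: i_def)
          also have "\<dots> = j * u" using j0 by (cases j) auto
          also have "\<dots> \<le> (d - 1) * u" using j by (intro mult_le_mono1) linarith
          finally have "(\<Sum>l<N+1. c i l * v l) = 0" by (rule v(2))
          moreover have "c i l = fps_nth (fps_X ^ l * F j) n" for l
            using j0 False by (simp add: c_def i1)
          ultimately show ?thesis
            by (simp add: fQ sum_distrib_right fps_sum_nth mult.assoc mult.commute[of "v _"] del: sum.lessThan_Suc)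
        qed
        then show ?thesis using False by (simp add: cP)
      qed
    qed
  qed
qed

section \<open>Iterating the functional equation\<close>

abbreviation subst_power :: "nat \<Rightarrow> int poly \<Rightarrow> int poly" where
  "subst_power k p \<equiv> pcompose p (monom 1 k)"

abbreviation poly_real :: "int poly \<Rightarrow> real \<Rightarrow> real" where
  "poly_real p x \<equiv> poly (of_int_poly p) x"

lemma poly_real_subst_power: "poly_real (subst_power k p) x = poly_real p (x ^ k)"
proof (induction p)
  case (pCons a p)
  then show ?case
    by (cases "a = 0")
       (auto simp: pcompose_pCons of_int_poly_hom.hom_add of_int_poly_hom.hom_mult map_poly_pCons
         poly_monom map_poly_monom)
qed simp

lemma fps_of_poly_subst_power:
  "k > 0 \<Longrightarrow> fps_of_poly (subst_power k p) = fps_of_poly p oo fps_X ^ k"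
  by (subst fps_of_poly_pcompose) (auto simp: fps_of_poly_monom)

lemma subst_power_eq_0_iff: "k > 0 \<Longrightarrow> subst_power k p = 0 \<longleftrightarrow> p = 0"
  by (subst pcompose_eq_0_iff) (auto simp: degree_monom_eq)

lemma subst_power_sum: "subst_power k (\<Sum>i\<in>S. f i) = (\<Sum>i\<in>S. subst_power k (f i))"
  by (induction S rule: infinite_finite_induct) (auto simp: pcompose_add)

lemma fps_X_power_dvd_compose:
  fixes f :: "int fps"
  assumes "fps_X ^ m dvd f" and "k > 0"
  shows "fps_X ^ (k * m) dvd f oo fps_X ^ k"
proof -
  from assms(1) obtain g where "f = fps_X ^ m * g" by blast
  then have "f oo fps_X ^ k = (fps_X ^ m oo fps_X ^ k) * (g oo fps_X ^ k)"
    using assms(2) by (simp add: fps_compose_mult_distrib)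
  also have "fps_X ^ m oo fps_X ^ k = (fps_X ^ (k * m) :: int fps)"
    using assms(2) by (simp add: fps_compose_power[symmetric] power_mult)
  finally show ?thesis by simp
qed

lemma subdegree_compose_fps_X_power:
  fixes f :: "int fps"
  assumes "k > 0"
  shows "subdegree (f oo fps_X ^ k) = k * subdegree f"
proof (cases "f = 0")
  case False
  define g where "g = fps_shift (subdegree f) f"
  have f: "f = g * fps_X ^ subdegree f" unfolding g_def by (rule subdegree_decompose)
  have g0: "fps_nth g 0 \<noteq> 0" using False by (simp add: g_def)
  have "f oo fps_X ^ k = (g oo fps_X ^ k) * (fps_X ^ subdegree f oo fps_X ^ k)"
    using assms by (subst f) (simp add: fps_compose_mult_distrib)
  also have "fps_X ^ subdegree f oo fps_X ^ k = (fps_X ^ (k * subdegree f) :: int fps)"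
    using assms by (simp add: fps_compose_power[symmetric] power_mult)
  finally have eq: "f oo fps_X ^ k = (g oo fps_X ^ k) * fps_X ^ (k * subdegree f)" .
  have "fps_nth (g oo fps_X ^ k) 0 \<noteq> 0" using g0 by simp
  then have "subdegree (g oo fps_X ^ k) = 0" "g oo fps_X ^ k \<noteq> 0"
    by (auto simp del: fps_compose_nth_0)
  then show ?thesis unfolding eq by (simp add: fps_X_power_subdegree)
qed simp

text \<open>The locale contains polynomials only. The functional equation enters later, once for
  formal power series and once for real functions, so both views share the same iterates.\<close>

locale mahler_iteration =
  fixes k d :: nat
    and A :: "nat \<Rightarrow> nat \<Rightarrow> int poly"
    and B :: "int poly"
    and Q :: "int poly"
    and P :: "nat \<Rightarrow> int poly"
  assumes k2: "k \<ge> 2"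
begin

primrec num :: "nat \<Rightarrow> nat \<Rightarrow> int poly" where
  "num 0 i = P i"
| "num (Suc n) i = (\<Sum>j<d. A i j * subst_power k (num n j))"

primrec den :: "nat \<Rightarrow> int poly" where
  "den 0 = Q"
| "den (Suc n) = B * subst_power k (den n)"

lemma degree_subst_power: "degree (subst_power k p) = k * degree p"
  by (simp add: degree_pcompose degree_monom_eq)

text \<open>The slack \<open>+ H\<close> makes the bound inductive: a step sends a degree e to at
  most H + k e, and 2 H + k e <= k (e + H) because k >= 2.\<close>

lemma degree_step:
  assumes "degree p + H \<le> E * k ^ n" and "degree a \<le> H"
  shows "degree (a * subst_power k p) + H \<le> E * k ^ Suc n"
proof -
  have "degree (a * subst_power k p) + H \<le> (H + k * degree p) + H"
    using degree_mult_le[of a "subst_power k p"] assms(2) by (simp only: degree_subst_power)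
  also have "\<dots> \<le> k * (degree p + H)"
  proof -
    have "2 * H \<le> k * H" using k2 by (rule mult_le_mono1)
    then show ?thesis unfolding distrib_left by linarith
  qed
  also have "\<dots> \<le> k * (E * k ^ n)"
    using assms(1) by (rule mult_le_mono2)
  finally show ?thesis by (simp add: mult.left_commute)
qed

lemma degree_den_le:
  assumes "degree Q + H \<le> E" and "degree B \<le> H"
  shows "degree (den n) + H \<le> E * k ^ n"
  using assms by (induction n) (auto simp del: power_Suc intro: degree_step)

lemma degree_num_le:
  assumes "\<And>j. degree (P j) + H \<le> E" and "\<And>i j. i < d \<Longrightarrow> j < d \<Longrightarrow> degree (A i j) \<le> H"
  shows "i < d \<Longrightarrow> degree (num n i) + H \<le> E * k ^ n"
proof (induction n arbitrary: i)
  case 0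
  then show ?case using assms(1) by simp
next
  case (Suc n)
  \<comment> \<open>The second fact guarantees that the natural subtraction in the first is not
    truncated.\<close>
  have *: "degree (A i j * subst_power k (num n j)) \<le> E * k ^ Suc n - H" 
      and **: "H \<le> E * k ^ Suc n" if "j < d" for j
    using degree_step[OF Suc.IH[OF that] assms(2)[OF Suc.prems that]] by linarith+
  have "degree (num (Suc n) i) \<le> E * k ^ Suc n - H"
    unfolding num.simps by (rule degree_sum_le) (use * in auto)
  with **[OF Suc.prems] show ?case by linarith
qed

text \<open>The remainders obey the recursion of the numerators: the new one is the matrix
  \<open>A\<close> applied to the old one at x^k. That substitution multiplies the order of
  vanishing by k.\<close>

lemma fps_X_power_dvd_remainder:
  assumes sys: "\<And>i. i < d \<Longrightarrow>
      fps_of_poly B * F i = (\<Sum>j<d. fps_of_poly (A i j) * (F j oo fps_X ^ k))"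
    and base: "\<And>j. j < d \<Longrightarrow> fps_X ^ M dvd fps_of_poly (P j) - fps_of_poly Q * F j"
  shows "i < d \<Longrightarrow> fps_X ^ (M * k ^ n) dvd fps_of_poly (num n i) - fps_of_poly (den n) * F i"
proof (induction n arbitrary: i)
  case 0
  then show ?case using base by simp
next
  case (Suc n)
  have k: "k > 0" using k2 by simp
  let ?s = "\<lambda>f :: int fps. f oo fps_X ^ k"
  let ?R = "\<lambda>j. fps_of_poly (num n j) - fps_of_poly (den n) * F j"
  have "fps_of_poly (num (Suc n) i) - fps_of_poly (den (Suc n)) * F i =
     (\<Sum>j<d. fps_of_poly (A i j) * ?s (fps_of_poly (num n j)))
      - ?s (fps_of_poly (den n)) * (fps_of_poly B * F i)"
    using k by (simp add: fps_of_poly_sum fps_of_poly_mult fps_of_poly_subst_power)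
  also have "\<dots> = (\<Sum>j<d. fps_of_poly (A i j) * ?s (?R j))"
    unfolding sys[OF Suc.prems] using k
    by (simp add: fps_compose_sub_distrib fps_compose_mult_distrib sum_distrib_left
        sum_subtractf algebra_simps)
  also have "fps_X ^ (M * k ^ Suc n) dvd \<dots>"
  proof (rule dvd_sum)
    fix j assume "j \<in> {..<d}"
    then have "fps_X ^ (k * (M * k ^ n)) dvd ?s (?R j)"
      using Suc.IH k by (intro fps_X_power_dvd_compose) auto
    then show "fps_X ^ (M * k ^ Suc n) dvd fps_of_poly (A i j) * ?s (?R j)"
      by (simp add: dvd_mult mult.left_commute)
  qed
  finally show ?case .
qed

text \<open>Since B(0) is nonzero, the factor \<open>B\<close> adds nothing to the order at 0, and
  each step just multiplies the order by k.\<close>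

lemma den_neq_0_and_subdegree_le:
  assumes "Q \<noteq> 0" and "poly B 0 \<noteq> 0"
  shows "den n \<noteq> 0 \<and> subdegree (fps_of_poly (den n)) \<le> degree Q * k ^ n"
proof (induction n)
  case 0
  have "subdegree (fps_of_poly Q) \<le> degree Q"
    by (rule subdegree_leI) (use assms in simp)
  then show ?case using assms by simp
next
  case (Suc n)
  have k: "k > 0" using k2 by simp
  have B: "B \<noteq> 0" "subdegree (fps_of_poly B) = 0"
    using assms(2) by (auto simp: poly_0_coeff_0 subdegree_eq_0_iff)
  have nz: "subst_power k (den n) \<noteq> 0" using Suc k by (simp add: subst_power_eq_0_iff)
  have "subdegree (fps_of_poly (den (Suc n))) = k * subdegree (fps_of_poly (den n))"
    using B nz k fps_of_poly_eq_iff[of B 0] fps_of_poly_eq_iff[of "subst_power k (den n)" 0]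
    by (simp add: fps_of_poly_mult fps_of_poly_subst_power subdegree_compose_fps_X_power)
  also have "\<dots> \<le> k * (degree Q * k ^ n)" using Suc by simp
  finally show ?case using B nz by (simp add: mult.left_commute)
qed

text \<open>The step W(x) -> A(x) W(x^k) is semilinear and sends \<open>num j\<close> to
  \<open>num (Suc j)\<close>. Once \<open>num r\<close> depends on its predecessors over Q(x), their
  span is therefore stable under the step and contains all later vectors. The multiplier
  \<open>e\<close> keeps the coefficients in Z[x].\<close>

lemma num_mem_span:
  assumes "r < d" and "g r \<noteq> 0"
    and rel: "\<And>i. i < d \<Longrightarrow> (\<Sum>j\<le>r. g j * num j i) = 0"
  shows "\<exists>e h. e \<noteq> 0 \<and> (\<forall>i<d. e * num n i = (\<Sum>j<r. h j * num j i))"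
proof (cases "n < r")
  case True
  then show ?thesis
    by (intro exI[of _ 1] exI[of _ "\<lambda>j. if j = n then 1 else 0"])
       (simp add: if_distrib[of "\<lambda>c. c * _"] cong: if_cong)
next
  case False
  have rel': "g r * num r i = (\<Sum>j<r. - g j * num j i)" if "i < d" for i
    using rel[OF that] by (simp add: lessThan_Suc_atMost[symmetric] sum_negf eq_neg_iff_add_eq_0 add.commute)
  from False have "r \<le> n" by simp
  then show ?thesis
  proof (induction n rule: dec_induct)
    case base
    then show ?case using rel' assms(2) by (intro exI[of _ "g r"] exI[of _ "\<lambda>j. - g j"]) auto
  next
    case (step n)
    then obtain e h where e: "e \<noteq> 0"
      and h: "\<And>i. i < d \<Longrightarrow> e * num n i = (\<Sum>j<r. h j * num j i)" by blast
    let ?s = "subst_power k"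
    have s: "?s e * num (Suc n) i = (\<Sum>j<r. ?s (h j) * num (Suc j) i)" if "i < d" for i
    proof -
      have "?s e * num (Suc n) i = (\<Sum>l<d. A i l * ?s (e * num n l))"
        by (simp add: sum_distrib_left pcompose_mult algebra_simps)
      also have "\<dots> = (\<Sum>l<d. A i l * ?s (\<Sum>j<r. h j * num j l))"
        using h by simp
      also have "\<dots> = (\<Sum>l<d. \<Sum>j<r. A i l * (?s (h j) * ?s (num j l)))"
        by (simp add: subst_power_sum pcompose_mult sum_distrib_left)
      also have "\<dots> = (\<Sum>j<r. \<Sum>l<d. A i l * (?s (h j) * ?s (num j l)))"
        by (rule sum.swap)
      also have "\<dots> = (\<Sum>j<r. ?s (h j) * num (Suc j) i)"
        by (simp add: sum_distrib_left algebra_simps)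
      finally show ?thesis .
    qed
    show ?case
    proof (cases r)
      case 0
      then show ?thesis using s e k2 subst_power_eq_0_iff[of k e] by (intro exI[of _ "?s e"]) auto
    next
      case (Suc r')
      \<comment> \<open>The step shifts the coefficients by one index. The term that overflows to
        index r is rewritten by \<open>rel'\<close>, at the price of the factor
        \<open>g r\<close>.\<close>
      define h' where "h' j = g r * (if j = 0 then 0 else ?s (h (j - 1))) - ?s (h r') * g j" for j
      have "g r * ?s e * num (Suc n) i = (\<Sum>j<r. h' j * num j i)" if "i < d" for i
      proof -
        have "g r * ?s e * num (Suc n) i = g r * (\<Sum>j<r'. ?s (h j) * num (Suc j) i)
            + ?s (h r') * (g r * num r i)"
          using s[OF that] by (simp add: Suc algebra_simps)
        also have "(\<Sum>j<r'. ?s (h j) * num (Suc j) i)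
            = (\<Sum>j<r. (if j = 0 then 0 else ?s (h (j - 1))) * num j i)"
          unfolding Suc sum.lessThan_Suc_shift by simp
        finally show ?thesis
          unfolding rel'[OF that] h'_def
          by (simp add: sum_distrib_left sum.distrib[symmetric] algebra_simps)
      qed
      moreover have "g r * ?s e \<noteq> 0" using assms(2) e k2 by (simp add: subst_power_eq_0_iff)
      ultimately show ?thesis by blast
    qed
  qed
qed

text \<open>If the determinant vanished, some nonzero \<open>L\<close> would annihilate every \<open>num n\<close>, so that
  \<open>den n\<close> times \<open>L \<cdot> F\<close> would vanish to order \<open>M k\<^sup>n\<close>, while \<open>den n\<close> vanishes to order at most
  \<open>degree Q \<cdot> k\<^sup>n\<close>.\<close>

lemma det_num_neq_0:
  assumes sys: "\<And>i. i < d \<Longrightarrow>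
      fps_of_poly B * F i = (\<Sum>j<d. fps_of_poly (A i j) * (F j oo fps_X ^ k))"
    and base: "\<And>j. j < d \<Longrightarrow> fps_X ^ M dvd fps_of_poly (P j) - fps_of_poly Q * F j"
    and Q: "Q \<noteq> 0" "degree Q < M" and B0: "poly B 0 \<noteq> 0"
    and indep: "\<And>L. (\<Sum>i<d. fps_of_poly (L i) * F i) = 0 \<Longrightarrow> \<forall>i<d. L i = 0"
  shows "det (mat d d (\<lambda>(j, i). num j i)) \<noteq> 0"
proof
  assume det: "det (mat d d (\<lambda>(j, i). num j i)) = 0"
  then obtain g where g: "\<exists>j<d. g j \<noteq> 0" "\<And>i. i < d \<Longrightarrow> (\<Sum>j<d. g j * num j i) = 0"
    unfolding det_eq_0_iff_left_kernel by blast
  from det obtain L where L: "\<exists>i<d. L i \<noteq> 0" "\<And>j. j < d \<Longrightarrow> (\<Sum>i<d. num j i * L i) = 0"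
    unfolding det_eq_0_iff_kernel by blast
  \<comment> \<open>The last index with a nonzero coefficient: it expresses \<open>num r\<close>
    through its predecessors.\<close>
  define r where "r = Max {j. j < d \<and> g j \<noteq> 0}"
  have "r \<in> {j. j < d \<and> g j \<noteq> 0}" unfolding r_def using g(1) by (intro Max_in) auto
  then have r: "r < d" "g r \<noteq> 0" by auto
  have rmax: "g j = 0" if "j < d" "r < j" for j
  proof (rule ccontr)
    assume "g j \<noteq> 0"
    then have "j \<le> r" unfolding r_def using that by (intro Max_ge) auto
    with that show False by simp
  qed
  have rel: "(\<Sum>j\<le>r. g j * num j i) = 0" if "i < d" for i
  proof -
    have "(\<Sum>j\<le>r. g j * num j i) = (\<Sum>j<d. g j * num j i)"
      using r rmax by (intro sum.mono_neutral_left) (auto simp: not_le)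
    then show ?thesis using g(2)[OF that] by simp
  qed
  have Ln: "(\<Sum>i<d. num n i * L i) = 0" for n
  proof -
    obtain e h where e: "e \<noteq> 0" and h: "\<And>i. i < d \<Longrightarrow> e * num n i = (\<Sum>j<r. h j * num j i)"
      using num_mem_span[OF r rel, of n] by blast
    have "e * (\<Sum>i<d. num n i * L i) = (\<Sum>i<d. (e * num n i) * L i)"
      by (simp add: sum_distrib_left mult.assoc)
    also have "\<dots> = (\<Sum>i<d. \<Sum>j<r. h j * (num j i * L i))"
      using h by (simp add: sum_distrib_right mult.assoc)
    also have "\<dots> = (\<Sum>j<r. \<Sum>i<d. h j * (num j i * L i))"
      by (rule sum.swap)
    also have "\<dots> = (\<Sum>j<r. h j * (\<Sum>i<d. num j i * L i))"
      by (simp add: sum_distrib_left)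
    also have "\<dots> = 0" using L(2) r(1) by (intro sum.neutral) auto
    finally show ?thesis using e by simp
  qed
  define G where "G = (\<Sum>i<d. fps_of_poly (L i) * F i)"
  have "G \<noteq> 0" using L(1) indep unfolding G_def by blast
  have "M * k ^ n \<le> degree Q * k ^ n + subdegree G" for n
  proof -
    have "fps_of_poly (den n) * G =
        - (\<Sum>i<d. fps_of_poly (L i) * (fps_of_poly (num n i) - fps_of_poly (den n) * F i))
        + fps_of_poly (\<Sum>i<d. num n i * L i)"
      by (simp add: G_def fps_of_poly_sum fps_of_poly_mult sum_distrib_left sum_subtractf
          algebra_simps)
    then have "fps_of_poly (den n) * G =
        - (\<Sum>i<d. fps_of_poly (L i) * (fps_of_poly (num n i) - fps_of_poly (den n) * F i))"
      by (simp only: Ln fps_of_poly_0 add_0_right)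
    moreover have "fps_X ^ (M * k ^ n) dvd
        - (\<Sum>i<d. fps_of_poly (L i) * (fps_of_poly (num n i) - fps_of_poly (den n) * F i))"
      unfolding dvd_minus_iff using fps_X_power_dvd_remainder[OF sys base]
      by (intro dvd_sum dvd_mult) auto
    ultimately have "fps_X ^ (M * k ^ n) dvd fps_of_poly (den n) * G" by simp
    then obtain T where T: "fps_of_poly (den n) * G = fps_X ^ (M * k ^ n) * T" by blast
    have nz: "fps_of_poly (den n) \<noteq> 0"
      using den_neq_0_and_subdegree_le[OF Q(1) B0, of n] fps_of_poly_eq_iff[of "den n" 0] by simp
    with T \<open>G \<noteq> 0\<close> have "T \<noteq> 0" by auto
    then have "M * k ^ n \<le> subdegree (fps_of_poly (den n) * G)"
      unfolding T by (simp add: fps_X_power_subdegree)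
    also have "\<dots> = subdegree (fps_of_poly (den n)) + subdegree G"
      using nz \<open>G \<noteq> 0\<close> by simp
    finally show ?thesis using den_neq_0_and_subdegree_le[OF Q(1) B0, of n] by linarith
  qed
  \<comment> \<open>As M exceeds deg Q, the inequality gives k^n <= \<open>subdegree G\<close> for
    every n; n = \<open>subdegree G\<close> already refutes it because n < k^n.\<close>
  from this[of "subdegree G"] have "(degree Q + 1) * k ^ subdegree G \<le> degree Q * k ^ subdegree G + subdegree G"
    using mult_le_mono1[of "degree Q + 1" M "k ^ subdegree G"] Q(2) by linarith
  then have "k ^ subdegree G \<le> subdegree G" by simp
  moreover have "subdegree G < k ^ subdegree G"
    using k2 by (intro power_gt_expt) auto
  ultimately show False by simp
qed

end

section \<open>Upper bounds for the irrationality exponent\<close>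

text \<open>For an exponent above the bound, only denominators below the threshold survive, and each
  of them admits finitely many numerators because the distance is less than 1.\<close>

lemma irrationality_exponent_le:
  assumes "\<mu>\<^sub>0 \<ge> 0"
    and lower: "\<And>p :: int. \<And>q :: nat. q \<ge> q\<^sub>0 \<Longrightarrow> q > 0 \<Longrightarrow> \<xi> \<noteq> of_int p / of_nat q \<Longrightarrow>
      of_nat q powr (- \<mu>\<^sub>0) \<le> \<bar>\<xi> - of_int p / of_nat q\<bar>"
  shows "irrationality_exponent \<xi> \<le> ereal \<mu>\<^sub>0"
  unfolding irrationality_exponent_def
proof (rule Sup_least, clarify)
  fix \<mu> :: real
  assume inf: "infinite {(p :: int, q :: nat). 0 < q \<and> 0 < \<bar>\<xi> - of_int p / of_nat q\<bar> \<and>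
      \<bar>\<xi> - of_int p / of_nat q\<bar> < of_nat q powr (- \<mu>)}" (is "infinite ?S")
  show "ereal \<mu> \<le> ereal \<mu>\<^sub>0"
  proof (rule ccontr)
    assume "\<not> ereal \<mu> \<le> ereal \<mu>\<^sub>0"
    then have mu: "\<mu> > \<mu>\<^sub>0" by simp
    define K where "K = \<lceil>(\<bar>\<xi>\<bar> + 1) * real q\<^sub>0\<rceil>"
    have "?S \<subseteq> {- K..K} \<times> {..<q\<^sub>0}"
    proof clarify
      fix p :: int and q :: nat
      assume q: "0 < q" and ne: "0 < \<bar>\<xi> - of_int p / of_nat q\<bar>"
        and lt: "\<bar>\<xi> - of_int p / of_nat q\<bar> < of_nat q powr (- \<mu>)"
      have le: "real q powr (- \<mu>) \<le> real q powr (- \<mu>\<^sub>0)"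
        using q mu by (intro powr_mono) auto
      have q0: "q < q\<^sub>0"
      proof (rule ccontr)
        assume "\<not> q < q\<^sub>0"
        then have "of_nat q powr (- \<mu>\<^sub>0) \<le> \<bar>\<xi> - of_int p / of_nat q\<bar>"
          using q ne by (intro lower) auto
        with lt le show False by linarith
      qed
      have "real q powr (- \<mu>\<^sub>0) \<le> real q powr 0"
        using q assms(1) by (intro powr_mono) auto
      with lt le q have "\<bar>\<xi> - of_int p / of_nat q\<bar> < 1" by simp
      then have "\<bar>of_int p / of_nat q\<bar> \<le> \<bar>\<xi>\<bar> + 1" by linarith
      then have "\<bar>real_of_int p\<bar> \<le> (\<bar>\<xi>\<bar> + 1) * real q"
        using q by (simp add: field_simps)
      also have "\<dots> \<le> (\<bar>\<xi>\<bar> + 1) * real q\<^sub>0"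
        using q0 by (intro mult_left_mono) auto
      also have "\<dots> \<le> of_int K" unfolding K_def by (rule le_of_int_ceiling)
      finally have "\<bar>p\<bar> \<le> K" by linarith
      then show "p \<in> {- K..K} \<and> q \<in> {..<q\<^sub>0}" using q0 by auto
    qed
    then have "finite ?S" by (rule finite_subset) auto
    with inf show False by blast
  qed
qed

text \<open>Among \<open>d\<close> consecutive approximations \<open>v m / u m\<close> at least one differs from \<open>p / q\<close>, and the
  first index is chosen so that \<open>\<beta> ^ k ^ n\<close> just exceeds \<open>q\<close>.\<close>

lemma irrationality_exponent_le_of_approximations:
  fixes u v :: "nat \<Rightarrow> int"
  assumes "k \<ge> 2" and "\<beta> > 1"
    and approx: "\<And>n. n \<ge> n\<^sub>0 \<Longrightarrow> \<bar>of_int (v n) - of_int (u n) * \<xi>\<bar> \<le> 1 / (2 * \<beta> ^ k ^ n)"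
    and size: "\<And>n. n \<ge> n\<^sub>0 \<Longrightarrow> \<bar>of_int (u n)\<bar> \<le> \<beta> ^ (E * k ^ n) / 2"
    and distinct: "\<And>n p q. n \<ge> n\<^sub>0 \<Longrightarrow> of_int q * \<xi> \<noteq> of_int p \<Longrightarrow>
      \<exists>j<d. q * v (n + j) \<noteq> p * u (n + j)"
  shows "irrationality_exponent \<xi> \<le> ereal (1 + real (E * k ^ d))"
proof (rule irrationality_exponent_le[where q\<^sub>0 = "nat \<lceil>\<beta> ^ k ^ n\<^sub>0\<rceil>"])
  fix p :: int and q :: nat
  assume q0: "nat \<lceil>\<beta> ^ k ^ n\<^sub>0\<rceil> \<le> q" and q: "q > 0" and ne: "\<xi> \<noteq> of_int p / of_nat q"
  have q0': "\<beta> ^ k ^ n\<^sub>0 \<le> real q" using q0 by linarith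
  obtain m where m: "real q < \<beta> ^ m" using real_arch_pow[OF assms(2)] by blast
  have "m < k ^ m" using assms(1) by (intro power_gt_expt) auto
  then have "\<beta> ^ m \<le> \<beta> ^ k ^ m" using assms(2) by (intro power_increasing) auto
  with m have ex: "\<exists>n. real q < \<beta> ^ k ^ n" by (intro exI[of _ m]) auto
  define n where "n = (LEAST n. real q < \<beta> ^ k ^ n)"
  have n: "real q < \<beta> ^ k ^ n" unfolding n_def by (rule LeastI_ex[OF ex])
  have "n\<^sub>0 < n"
  proof (rule ccontr)
    assume "\<not> n\<^sub>0 < n"
    then have "\<beta> ^ k ^ n \<le> \<beta> ^ k ^ n\<^sub>0"
      using assms(1,2) by (intro power_increasing) auto
    with n q0' show False by simp
  qed
  \<comment> \<open>The threshold on q puts n past the starting index, so n is a successor; by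
    minimality the power at n' is still at most q.\<close>
  then obtain n' where n': "n = Suc n'" by (cases n) auto
  have "\<not> real q < \<beta> ^ k ^ n'" unfolding n_def[symmetric]
    using not_less_Least[of n' "\<lambda>n. real q < \<beta> ^ k ^ n"] n' by (simp add: n_def)
  then have n'q: "\<beta> ^ k ^ n' \<le> real q" by simp
  have "of_int (int q) * \<xi> \<noteq> of_int p" using ne q by (auto simp: field_simps)
  with distinct[of n "int q" p] \<open>n\<^sub>0 < n\<close> obtain j where j: "j < d"
    and neq: "int q * v (n + j) \<noteq> p * u (n + j)" by auto
  define l where "l = n + j"
  have l: "n\<^sub>0 \<le> l" "n \<le> l" using \<open>n\<^sub>0 < n\<close> by (auto simp: l_def)
  let ?e = "\<bar>real q * \<xi> - of_int p\<bar>"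
  \<comment> \<open>A nonzero integer has absolute value at least 1. Split it into the approximation
    error times q, at most 1/2, and a multiple of |q xi - p|; the halves in \<open>approx\<close>
    and \<open>size\<close> are there for this.\<close>
  have "1 \<le> \<bar>int q * v l - p * u l\<bar>" using neq by (simp add: l_def)
  then have "1 \<le> real_of_int \<bar>int q * v l - p * u l\<bar>" by linarith
  also have "\<dots> = \<bar>real q * (of_int (v l) - of_int (u l) * \<xi>) + of_int (u l) * (real q * \<xi> - of_int p)\<bar>"
    by (simp add: algebra_simps)
  also have "\<dots> \<le> real q * \<bar>of_int (v l) - of_int (u l) * \<xi>\<bar> + \<bar>of_int (u l)\<bar> * ?e"
    by (rule order_trans[OF abs_triangle_ineq]) (simp add: abs_mult)
  also have "\<dots> \<le> real q * (1 / (2 * \<beta> ^ k ^ l)) + \<beta> ^ (E * k ^ l) / 2 * ?e"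
    using approx[OF l(1)] size[OF l(1)] by (intro add_mono mult_left_mono mult_right_mono) auto
  also have "real q * (1 / (2 * \<beta> ^ k ^ l)) \<le> 1 / 2"
  proof -
    have "\<beta> ^ k ^ n \<le> \<beta> ^ k ^ l" using assms(1,2) l(2) by (intro power_increasing) auto
    with n have "real q \<le> \<beta> ^ k ^ l" by simp
    then show ?thesis using assms(2) by (simp add: field_simps)
  qed
  finally have e: "1 \<le> \<beta> ^ (E * k ^ l) * ?e" by simp
  \<comment> \<open>From n = n' + 1 and j < d follows l <= n' + d; this is the source of the factor
    k^d.\<close>
  have "E * k ^ l \<le> (k ^ n') * (E * k ^ d)"
  proof -
    have "k ^ l \<le> k ^ (n' + d)" using assms(1) j n' by (intro power_increasing) (auto simp: l_def)
    then show ?thesis by (simp add: power_add mult.left_commute)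
  qed
  then have "\<beta> ^ (E * k ^ l) \<le> (\<beta> ^ k ^ n') ^ (E * k ^ d)"
    unfolding power_mult[symmetric] using assms(2) by (intro power_increasing) auto
  also have "\<dots> \<le> real q ^ (E * k ^ d)" using n'q assms(2) by (intro power_mono) auto
  finally have "\<beta> ^ (E * k ^ l) * ?e \<le> real q ^ (E * k ^ d) * ?e" by (intro mult_right_mono) auto
  with e have "1 \<le> real q ^ (E * k ^ d) * ?e" by linarith
  \<comment> \<open>Passing from |q xi - p| to |xi - p/q| costs one factor q, the summand 1 in the
    exponent.\<close>
  also have "?e = real q * \<bar>\<xi> - of_int p / of_nat q\<bar>"
  proof -
    have "real q * \<xi> - of_int p = real q * (\<xi> - of_int p / of_nat q)" using q by (simp add: field_simps)
    then show ?thesis by (simp add: abs_mult)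
  qed
  finally have "1 / real q ^ (E * k ^ d + 1) \<le> \<bar>\<xi> - of_int p / of_nat q\<bar>"
    using q by (simp add: field_simps)
  moreover have "1 / real q ^ (E * k ^ d + 1) = real q powr (- (1 + real (E * k ^ d)))"
    using powr_realpow[of "real q" "E * k ^ d + 1"] q
    by (simp only: powr_minus_divide of_nat_add of_nat_1 add.commute[of 1] of_nat_0_less_iff)
  ultimately show "of_nat q powr (- (1 + real (E * k ^ d))) \<le> \<bar>\<xi> - of_int p / of_nat q\<bar>" by simp
qed simp

text \<open>With E = (d^2 - 1)(H + 2) + H, the number E + 1 is d^2 (H + 2) - 1. The estimate m < 2^m
  turns both factors into powers of 2, and all of these except 2^H are traded for powers of k. The
  leading 1 costs one more factor k, so k gets exponent d^2 + d + 3, which is at most 5 d^2.\<close>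

lemma mahler_exponent_bound:
  fixes d H k :: nat
  assumes "d \<ge> 2" and "k \<ge> 2"
  shows "1 + (((d\<^sup>2 - 1) * (H + 2) + H) + 1) * k ^ d < 4 ^ (H * d\<^sup>2) * k ^ (5 * d\<^sup>2)"
proof -
  have d4: "4 \<le> d\<^sup>2" using power_mono[OF assms(1), of 2] by simp
  have "((d\<^sup>2 - 1) * (H + 2) + H) + 1 \<le> d\<^sup>2 * (H + 2)"
    using d4 by (cases "d\<^sup>2") auto
  also have "\<dots> \<le> 2 ^ d\<^sup>2 * 2 ^ (H + 2)"
    using less_exp[of "d\<^sup>2"] less_exp[of "H + 2"] by (intro mult_le_mono less_imp_le)
  also have "\<dots> \<le> k ^ (d\<^sup>2 + 2) * 2 ^ H"
    using power_mono[OF assms(2), of "d\<^sup>2 + 2"] by (simp add: power_add mult_ac)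
  also have "\<dots> \<le> k ^ (d\<^sup>2 + 2) * 4 ^ (H * d\<^sup>2)"
  proof -
    have "(2 :: nat) ^ H \<le> 2 ^ (2 * (H * d\<^sup>2))" using d4 by (intro power_increasing) auto
    then show ?thesis by (simp add: power_mult)
  qed
  finally have "1 + (((d\<^sup>2 - 1) * (H + 2) + H) + 1) * k ^ d
      \<le> 1 + k ^ (d\<^sup>2 + 2) * 4 ^ (H * d\<^sup>2) * k ^ d"
    by (intro add_left_mono mult_right_mono) auto
  also have "\<dots> < 2 * (k ^ (d\<^sup>2 + 2) * 4 ^ (H * d\<^sup>2) * k ^ d)"
  proof -
    have "1 * 1 < k ^ (d\<^sup>2 + 2) * (4 ^ (H * d\<^sup>2) * k ^ d)"
      using assms by (intro mult_less_le_imp_less one_less_power) auto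
    then show ?thesis by (simp add: mult_ac)
  qed
  also have "\<dots> \<le> k * (k ^ (d\<^sup>2 + 2) * 4 ^ (H * d\<^sup>2) * k ^ d)"
    using assms(2) by (rule mult_le_mono1)
  also have "\<dots> = 4 ^ (H * d\<^sup>2) * k ^ (1 + (d\<^sup>2 + 2) + d)"
    by (simp add: power_add)
  also have "\<dots> \<le> 4 ^ (H * d\<^sup>2) * k ^ (5 * d\<^sup>2)"
  proof -
    have "d \<le> d\<^sup>2" by (simp add: power2_eq_square)
    then have "1 + (d\<^sup>2 + 2) + d \<le> 5 * d\<^sup>2" using d4 by linarith
    then show ?thesis using assms(2) by (intro mult_le_mono2 power_increasing) auto
  qed
  finally show ?thesis .
qed

section \<open>Values of the iterated approximations\<close>

lemma abs_poly_real_le: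
  assumes "\<bar>x\<bar> \<le> 1"
  shows "\<bar>poly_real p x\<bar> \<le> (\<Sum>i\<le>degree p. \<bar>of_int (coeff p i)\<bar>)"
proof -
  have "\<bar>poly_real p x\<bar> \<le> (\<Sum>i\<le>degree p. \<bar>of_int (coeff p i) * x ^ i\<bar>)"
    by (simp add: poly_altdef sum_abs)
  also have "\<dots> \<le> (\<Sum>i\<le>degree p. \<bar>of_int (coeff p i)\<bar>)"
    using assms by (intro sum_mono) (simp add: abs_mult power_abs mult_left_le power_le_one)
  finally show ?thesis .
qed

lemma poly_real_denominator:
  assumes "degree p \<le> e" and "b \<noteq> 0"
  shows "\<exists>z :: int. of_int z = real_of_int b ^ e * poly_real p (of_int a / of_int b)"
proof
  have "real_of_int b ^ e * (of_int a / of_int b) ^ i = of_int (a ^ i * b ^ (e - i))" if "i \<le> e" for i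
  proof -
    have "real_of_int b ^ e = of_int b ^ (e - i) * of_int b ^ i"
      using that by (simp add: power_add[symmetric])
    then show ?thesis using assms(2) by (simp add: power_divide)
  qed
  then show "of_int (\<Sum>i\<le>degree p. coeff p i * (a ^ i * b ^ (e - i)))
      = real_of_int b ^ e * poly_real p (of_int a / of_int b)"
    using assms(1) by (simp add: poly_altdef sum_distrib_left mult.left_commute)
qed

lemma exponential_le_double_exponential:
  fixes \<beta> C K :: real
  assumes "\<beta> > 1" and "k \<ge> (2 :: nat)"
  obtains n\<^sub>0 where "\<And>n. n \<ge> n\<^sub>0 \<Longrightarrow> K * C ^ n \<le> \<beta> ^ k ^ n"
proof -
  obtain s where s: "max \<bar>K\<bar> \<bar>C\<bar> < \<beta> ^ s" using real_arch_pow[OF assms(1)] by blast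
  show ?thesis
  \<comment> \<open>With n = s + t and s^2 <= t one has s (n + 1) <= (s + 1)(t + 1) <= 2^s 2^t =
    2^n.\<close>
  proof (rule that[of "s + s * s"])
    fix n assume n: "n \<ge> s + s * s"
    define t where "t = n - s"
    have t: "n = s + t" "s * s \<le> t" using n by (auto simp: t_def)
    have "s * (n + 1) \<le> (s + 1) * (t + 1)" using t by (simp add: algebra_simps)
    also have "\<dots> \<le> 2 ^ s * 2 ^ t"
      using less_exp[of s] less_exp[of t]
      by (intro mult_le_mono) (simp_all only: Suc_eq_plus1[symmetric] Suc_le_eq)
    also have "\<dots> = 2 ^ n" by (simp add: t(1) power_add)
    also have "\<dots> \<le> k ^ n" using assms(2) by (rule power_mono) simp
    finally have le: "s * (n + 1) \<le> k ^ n" .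
    have "K * C ^ n \<le> \<bar>K\<bar> * \<bar>C\<bar> ^ n" by (metis abs_ge_self abs_mult power_abs)
    also have "\<dots> \<le> \<beta> ^ s * (\<beta> ^ s) ^ n"
      using s assms(1) by (intro mult_mono power_mono) auto
    also have "\<dots> = \<beta> ^ (s * (n + 1))" by (simp add: power_mult[symmetric] power_add[symmetric])
    also have "\<dots> \<le> \<beta> ^ k ^ n" using le assms(1) by (intro power_increasing) auto
    finally show "K * C ^ n \<le> \<beta> ^ k ^ n" .
  qed
qed

context mahler_iteration
begin

lemma poly_real_num_Suc:
  "poly_real (num (Suc n) i) x = (\<Sum>j<d. poly_real (A i j) x * poly_real (num n j) (x ^ k))"
  by (simp add: of_int_poly_hom.hom_sum of_int_poly_hom.hom_mult poly_sum poly_real_subst_power)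

lemma poly_real_den_Suc: "poly_real (den (Suc n)) x = poly_real B x * poly_real (den n) (x ^ k)"
  by (simp add: of_int_poly_hom.hom_mult poly_real_subst_power)

text \<open>A polynomial of degree below M k^n that is divisible by x^(M k^n) is zero. Thus the
  common denominator is itself a coordinate of the vector of numerators, and comparing an
  approximation with p/q becomes a linear form in that vector.\<close>

lemma num_0_eq_den:
  assumes sys: "\<And>i. i < d \<Longrightarrow>
      fps_of_poly B * F i = (\<Sum>j<d. fps_of_poly (A i j) * (F j oo fps_X ^ k))"
    and base: "\<And>j. j < d \<Longrightarrow> fps_X ^ M dvd fps_of_poly (P j) - fps_of_poly Q * F j"
    and "F 0 = 1" and "d > 0" and "E < M"
    and "degree (num n 0) \<le> E * k ^ n" and "degree (den n) \<le> E * k ^ n"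
  shows "num n 0 = den n"
proof (rule poly_eqI)
  fix m
  have "fps_X ^ (M * k ^ n) dvd fps_of_poly (num n 0) - fps_of_poly (den n) * F 0"
    using sys base \<open>d > 0\<close> by (rule fps_X_power_dvd_remainder)
  then obtain T where T: "fps_of_poly (num n 0) - fps_of_poly (den n) = fps_X ^ (M * k ^ n) * T"
    using \<open>F 0 = 1\<close> by auto
  show "coeff (num n 0) m = coeff (den n) m"
  proof (cases "m < M * k ^ n")
    case True
    then show ?thesis using arg_cong[OF T, of "\<lambda>f. fps_nth f m"] by (simp add: fps_X_power_mult_nth)
  next
    case False
    have "E * k ^ n < M * k ^ n" using \<open>E < M\<close> k2 by simp
    then have "degree (num n 0) < m" "degree (den n) < m" using False assms(6,7) by linarith+
    then show ?thesis by (simp add: coeff_eq_0)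
  qed
qed

end

text \<open>The equation is required on a whole closed disc of radius below 1, since each step moves
  the point from y to y^k; such a disc is stable under this map.\<close>

locale mahler_values = mahler_iteration +
  fixes f :: "nat \<Rightarrow> real \<Rightarrow> real" and r :: real
  assumes r1: "r < 1"
    and feq: "\<And>i y. i < d \<Longrightarrow> \<bar>y\<bar> \<le> r \<Longrightarrow>
      poly_real B y * f i y = (\<Sum>j<d. poly_real (A i j) y * f j (y ^ k))"
begin

lemma abs_power_k_le: "\<bar>y\<bar> \<le> r \<Longrightarrow> \<bar>y ^ k\<bar> \<le> r"
  using power_decreasing[of 1 k "\<bar>y\<bar>"] k2 r1 by (simp add: power_abs)

lemma remainder_Suc:
  assumes "i < d" and "\<bar>y\<bar> \<le> r"
  shows "poly_real (num (Suc n) i) y - poly_real (den (Suc n)) y * f i y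
    = (\<Sum>j<d. poly_real (A i j) y * (poly_real (num n j) (y ^ k) - poly_real (den n) (y ^ k) * f j (y ^ k)))"
proof -
  have "poly_real (den (Suc n)) y * f i y = poly_real (den n) (y ^ k) * (poly_real B y * f i y)"
    by (simp only: poly_real_den_Suc mult_ac)
  then show ?thesis
    unfolding feq[OF assms] poly_real_num_Suc
    by (simp add: sum_distrib_left sum_subtractf algebra_simps)
qed

lemma remainder_bound:
  assumes C: "\<And>i y. i < d \<Longrightarrow> \<bar>y\<bar> \<le> r \<Longrightarrow> (\<Sum>j<d. \<bar>poly_real (A i j) y\<bar>) \<le> C"
    and K: "\<And>i y. i < d \<Longrightarrow> \<bar>y\<bar> \<le> r \<Longrightarrow> \<bar>poly_real (P i) y - poly_real Q y * f i y\<bar> \<le> K * \<bar>y\<bar> ^ M"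
    and "K \<ge> 0" and "C \<ge> 0"
  shows "i < d \<Longrightarrow> \<bar>y\<bar> \<le> r \<Longrightarrow>
    \<bar>poly_real (num n i) y - poly_real (den n) y * f i y\<bar> \<le> K * C ^ n * \<bar>y\<bar> ^ (M * k ^ n)"
proof (induction n arbitrary: i y)
  case 0
  then show ?case using K by simp
next
  case (Suc n)
  let ?R = "\<lambda>j. poly_real (num n j) (y ^ k) - poly_real (den n) (y ^ k) * f j (y ^ k)"
  have R: "\<bar>?R j\<bar> \<le> K * C ^ n * \<bar>y\<bar> ^ (M * k ^ Suc n)" if "j < d" for j
    using Suc.IH[OF that abs_power_k_le[OF Suc.prems(2)]]
    by (simp add: power_abs power_mult[symmetric] mult_ac)
  have "\<bar>poly_real (num (Suc n) i) y - poly_real (den (Suc n)) y * f i y\<bar>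
      \<le> (\<Sum>j<d. \<bar>poly_real (A i j) y\<bar> * \<bar>?R j\<bar>)"
    unfolding remainder_Suc[OF Suc.prems] by (rule order_trans[OF sum_abs]) (simp add: abs_mult)
  also have "\<dots> \<le> (\<Sum>j<d. \<bar>poly_real (A i j) y\<bar> * (K * C ^ n * \<bar>y\<bar> ^ (M * k ^ Suc n)))"
    using R by (intro sum_mono mult_left_mono) auto
  also have "\<dots> = (\<Sum>j<d. \<bar>poly_real (A i j) y\<bar>) * (K * C ^ n * \<bar>y\<bar> ^ (M * k ^ Suc n))"
    by (rule sum_distrib_right[symmetric])
  also have "\<dots> \<le> C * (K * C ^ n * \<bar>y\<bar> ^ (M * k ^ Suc n))"
    using C[OF Suc.prems] assms(3,4) by (intro mult_right_mono) auto
  finally show ?case by (simp add: mult_ac)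
qed

lemma den_bound:
  assumes "\<And>y. \<bar>y\<bar> \<le> r \<Longrightarrow> \<bar>poly_real B y\<bar> \<le> C" and "\<And>y. \<bar>y\<bar> \<le> r \<Longrightarrow> \<bar>poly_real Q y\<bar> \<le> K"
    and "C \<ge> 0"
  shows "\<bar>y\<bar> \<le> r \<Longrightarrow> \<bar>poly_real (den n) y\<bar> \<le> K * C ^ n"
proof (induction n arbitrary: y)
  case (Suc n)
  have "\<bar>poly_real (den (Suc n)) y\<bar> = \<bar>poly_real B y\<bar> * \<bar>poly_real (den n) (y ^ k)\<bar>"
    by (simp only: poly_real_den_Suc abs_mult)
  also have "\<dots> \<le> C * (K * C ^ n)"
    using assms(1,3) Suc.prems Suc.IH[OF abs_power_k_le] by (intro mult_mono) auto
  finally show ?case by (simp add: mult_ac)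
qed (use assms in simp)

text \<open>Multiply the row vector v successively by A(x), A(x^k), and so on; the resulting
  \<open>v'\<close> serves all j at once. On the values of f this costs only factors B(x^(k^m)),
  which are nonzero.\<close>

lemma transfer_linear_form:
  assumes "\<bar>x\<bar> \<le> r" and "\<And>m. poly_real B (x ^ k ^ m) \<noteq> 0"
  shows "\<exists>v'. (\<forall>j. (\<Sum>i<d. v i * poly_real (num (n + j) i) x) = (\<Sum>i<d. v' i * poly_real (num j i) (x ^ k ^ n)))
    \<and> ((\<Sum>i<d. v' i * f i (x ^ k ^ n)) = 0 \<longrightarrow> (\<Sum>i<d. v i * f i x) = 0)"
  using assms
proof (induction n arbitrary: x v)
  case 0
  show ?case by (intro exI[of _ v]) simp
next
  case (Suc n)
  define w where "w l = (\<Sum>i<d. v i * poly_real (A i l) x)" for l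
  have swap: "(\<Sum>i<d. v i * (\<Sum>l<d. poly_real (A i l) x * g l)) = (\<Sum>l<d. w l * g l)" for g
    unfolding w_def sum_distrib_left sum_distrib_right mult.assoc by (rule sum.swap)
  have pow: "(x ^ k) ^ k ^ m = x ^ k ^ Suc m" for m by (simp add: power_mult[symmetric])
  have "poly_real B ((x ^ k) ^ k ^ m) \<noteq> 0" for m
    unfolding pow by (rule Suc.prems(2))
  from Suc.IH[OF abs_power_k_le[OF Suc.prems(1)] this, of w]
  obtain v' where v': "\<And>j. (\<Sum>l<d. w l * poly_real (num (n + j) l) (x ^ k))
        = (\<Sum>i<d. v' i * poly_real (num j i) (x ^ k ^ Suc n))"
    and zero: "(\<Sum>i<d. v' i * f i (x ^ k ^ Suc n)) = 0 \<Longrightarrow> (\<Sum>l<d. w l * f l (x ^ k)) = 0"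
    unfolding pow by blast
  have "(\<Sum>i<d. v i * poly_real (num (Suc n + j) i) x)
      = (\<Sum>i<d. v' i * poly_real (num j i) (x ^ k ^ Suc n))" for j
    using v'[of j] by (simp only: add_Suc poly_real_num_Suc swap)
  moreover have "(\<Sum>i<d. v i * f i x) = 0" if "(\<Sum>i<d. v' i * f i (x ^ k ^ Suc n)) = 0"
  proof -
    have "poly_real B x * (\<Sum>i<d. v i * f i x) = (\<Sum>i<d. v i * (poly_real B x * f i x))"
      by (simp add: sum_distrib_left mult.left_commute)
    also have "\<dots> = (\<Sum>i<d. v i * (\<Sum>l<d. poly_real (A i l) x * f l (x ^ k)))"
      using feq Suc.prems(1) by simp
    also have "\<dots> = 0" unfolding swap using zero[OF that] .
    finally show ?thesis using Suc.prems(2)[of 0] by simp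
  qed
  ultimately show ?case by blast
qed

text \<open>For large n the vectors \<open>num j\<close>, j < d, stay independent at x^(k^n), so the
  transferred form is zero. Its origin v need not be zero, because the transfer matrices may be
  singular; hence the conclusion concerns only the value of the form on f.\<close>

lemma linear_form_vanishes:
  assumes x: "x \<noteq> 0" "\<bar>x\<bar> \<le> r" and B: "\<And>m. poly_real B (x ^ k ^ m) \<noteq> 0"
    and det: "det (mat d d (\<lambda>(j, i). num j i)) \<noteq> 0"
  obtains n\<^sub>0 where "\<And>n v. n \<ge> n\<^sub>0 \<Longrightarrow> (\<And>j. j < d \<Longrightarrow> (\<Sum>i<d. v i * poly_real (num (n + j) i) x) = 0)
    \<Longrightarrow> (\<Sum>i<d. v i * f i x) = 0"
proof -
  let ?D = "det (mat d d (\<lambda>(j, i). num j i))"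
  have D: "det (mat d d (\<lambda>(j, i). poly_real (num j i) y)) = poly_real ?D y" for y
  proof -
    interpret h: comm_ring_hom "\<lambda>p. poly_real p y"
      by unfold_locales (simp_all add: of_int_poly_hom.hom_add of_int_poly_hom.hom_mult)
    have "map_mat (\<lambda>p. poly_real p y) (mat d d (\<lambda>(j, i). num j i))
        = mat d d (\<lambda>(j, i). poly_real (num j i) y)"
      by (intro eq_matI) auto
    then show ?thesis using h.hom_det[of "mat d d (\<lambda>(j, i). num j i)"] by simp
  qed
  have "of_int_poly ?D \<noteq> (0 :: real poly)" using det by simp
  then have fin: "finite {y. poly_real ?D y = 0}" by (rule poly_roots_finite)
  \<comment> \<open>As 0 < |x| < 1, these points are distinct, so only finitely many of them are
    roots of the determinant.\<close>
  have "inj (\<lambda>n. x ^ k ^ n)"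
  proof (rule linorder_injI)
    fix m n :: nat assume "m < n"
    then have "k ^ m < k ^ n" using k2 by (intro power_strict_increasing) auto
    then have "\<bar>x\<bar> ^ k ^ n < \<bar>x\<bar> ^ k ^ m" 
      by (rule power_strict_decreasing) (use x r1 in auto)
    then show "x ^ k ^ m \<noteq> x ^ k ^ n" by (metis power_abs less_irrefl)
  qed
  from finite_vimageI[OF fin this] obtain n\<^sub>0 where n0: "\<And>n. poly_real ?D (x ^ k ^ n) = 0 \<Longrightarrow> n < n\<^sub>0"
    unfolding finite_nat_set_iff_bounded by auto
  show ?thesis
  proof (rule that[of n\<^sub>0])
    fix n v
    assume n: "n \<ge> n\<^sub>0" and v: "\<And>j. j < d \<Longrightarrow> (\<Sum>i<d. v i * poly_real (num (n + j) i) x) = 0"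
    obtain v' where v': "\<And>j. (\<Sum>i<d. v i * poly_real (num (n + j) i) x)
          = (\<Sum>i<d. v' i * poly_real (num j i) (x ^ k ^ n))"
      and zero: "(\<Sum>i<d. v' i * f i (x ^ k ^ n)) = 0 \<Longrightarrow> (\<Sum>i<d. v i * f i x) = 0"
      using transfer_linear_form[OF x(2) B] by blast
    have "det (mat d d (\<lambda>(j, i). poly_real (num j i) (x ^ k ^ n))) \<noteq> 0"
      unfolding D using n0[of n] n by auto
    moreover have "(\<Sum>i<d. poly_real (num j i) (x ^ k ^ n) * v' i) = 0" if "j < d" for j
      using v[OF that] v'[of j] by (simp add: mult.commute)
    ultimately have "\<forall>i<d. v' i = 0"
      unfolding det_eq_0_iff_kernel by blast
    then show "(\<Sum>i<d. v i * f i x) = 0" by (intro zero sum.neutral) auto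
  qed
qed

text \<open>Multiplication by b^(E k^n) makes numerators and denominators integers. The denominators
  may still grow by C^n, and absorbing this growth into b^(k^n) turns E into E + 1.\<close>

lemma irrationality_exponent_value_le:
  fixes a b :: int and i\<^sub>0 :: nat
  defines "x \<equiv> of_int a / of_int b"
  assumes "a \<noteq> 0" and b: "b \<ge> 2" and xr: "\<bar>x\<bar> \<le> r"
    and B: "\<And>m. poly_real B (x ^ k ^ m) \<noteq> 0"
    and det: "det (mat d d (\<lambda>(j, i). num j i)) \<noteq> 0"
    and base: "\<And>i y. i < d \<Longrightarrow> \<bar>y\<bar> \<le> r \<Longrightarrow> \<bar>poly_real (P i) y - poly_real Q y * f i y\<bar> \<le> K * \<bar>y\<bar> ^ M"
    and degs: "\<And>n i. i < d \<Longrightarrow> degree (num n i) \<le> E * k ^ n" "\<And>n. degree (den n) \<le> E * k ^ n"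
    and num0: "\<And>n. num n 0 = den n" and f0: "f 0 x = 1" and "i\<^sub>0 < d"
    and EM: "real_of_int b ^ (E + 2) * \<bar>x\<bar> ^ M \<le> 1"
  shows "irrationality_exponent (f i\<^sub>0 x) \<le> ereal (1 + real ((E + 1) * k ^ d))"
proof -
  let ?len = "\<lambda>p :: int poly. \<Sum>i\<le>degree p. \<bar>real_of_int (coeff p i)\<bar>"
  let ?b = "real_of_int b"
  have b0: "?b > 1" "b \<noteq> 0" using b by auto
  have x0: "x \<noteq> 0" using \<open>a \<noteq> 0\<close> b0 by (simp add: x_def)
  define C where "C = (\<Sum>i<d. \<Sum>j<d. ?len (A i j)) + ?len B"
  define K' where "K' = \<bar>K\<bar> + ?len Q"
  have lenB: "0 \<le> ?len B" and lenA: "0 \<le> (\<Sum>i<d. \<Sum>j<d. ?len (A i j))" and lenQ: "0 \<le> ?len Q"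
    by (intro sum_nonneg; simp)+
  have KK': "K \<le> K'" using lenQ unfolding K'_def by linarith
  have C0: "C \<ge> 0" and K0: "K' \<ge> 0" using lenA lenB lenQ by (auto simp: C_def K'_def)
  have CA: "(\<Sum>j<d. \<bar>poly_real (A i j) y\<bar>) \<le> C" if "i < d" "\<bar>y\<bar> \<le> r" for i y
  proof -
    have "(\<Sum>j<d. \<bar>poly_real (A i j) y\<bar>) \<le> (\<Sum>j<d. ?len (A i j))"
      using that r1 by (intro sum_mono abs_poly_real_le) auto
    also have "\<dots> \<le> (\<Sum>i<d. \<Sum>j<d. ?len (A i j))"
      using that by (intro member_le_sum[of i "{..<d}" "\<lambda>i. \<Sum>j<d. ?len (A i j)"] sum_nonneg) auto
    finally show ?thesis using lenB unfolding C_def by linarith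
  qed
  have CB: "\<bar>poly_real B y\<bar> \<le> C" if "\<bar>y\<bar> \<le> r" for y
    using abs_poly_real_le[of y B] that r1 lenA by (simp add: C_def)
  have KQ: "\<bar>poly_real Q y\<bar> \<le> K'" if "\<bar>y\<bar> \<le> r" for y
    using abs_poly_real_le[of y Q] that r1 by (simp add: K'_def)
  have KR: "\<bar>poly_real (P i) y - poly_real Q y * f i y\<bar> \<le> K' * \<bar>y\<bar> ^ M" if "i < d" "\<bar>y\<bar> \<le> r" for i y
  proof -
    have "K * \<bar>y\<bar> ^ M \<le> K' * \<bar>y\<bar> ^ M" using KK' by (intro mult_right_mono) auto
    with base[OF that] show ?thesis by linarith
  qed
  obtain n\<^sub>1 where n1: "\<And>n. n \<ge> n\<^sub>1 \<Longrightarrow> (2 * K') * C ^ n \<le> ?b ^ k ^ n"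
    using exponential_le_double_exponential[OF b0(1) k2] by blast
  obtain n\<^sub>2 where n2: "\<And>n v. n \<ge> n\<^sub>2 \<Longrightarrow>
      (\<And>j. j < d \<Longrightarrow> (\<Sum>i<d. v i * poly_real (num (n + j) i) x) = 0) \<Longrightarrow> (\<Sum>i<d. v i * f i x) = 0"
    using linear_form_vanishes[OF x0 xr B det] by blast
  have "\<exists>z :: int. of_int z = ?b ^ (E * k ^ n) * poly_real (den n) x" for n
    unfolding x_def by (rule poly_real_denominator[OF degs(2) b0(2)])
  then obtain u where u: "\<And>n. real_of_int (u n) = ?b ^ (E * k ^ n) * poly_real (den n) x"
    by metis
  have "\<exists>z :: int. of_int z = ?b ^ (E * k ^ n) * poly_real (num n i\<^sub>0) x" for n
    unfolding x_def by (rule poly_real_denominator[OF degs(1) b0(2)]) fact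
  then obtain v where v: "\<And>n. real_of_int (v n) = ?b ^ (E * k ^ n) * poly_real (num n i\<^sub>0) x"
    by metis
  show ?thesis
  proof (rule irrationality_exponent_le_of_approximations[OF k2 b0(1), where n\<^sub>0 = "max n\<^sub>1 n\<^sub>2"])
    fix n assume n: "max n\<^sub>1 n\<^sub>2 \<le> n"
    let ?\<beta> = "?b ^ k ^ n"
    have \<beta>: "?\<beta> > 0" using b0 by simp
    have KC: "K' * C ^ n \<le> ?\<beta> / 2" using n1[of n] n by simp
    have "of_int (v n) - of_int (u n) * f i\<^sub>0 x
        = ?b ^ (E * k ^ n) * (poly_real (num n i\<^sub>0) x - poly_real (den n) x * f i\<^sub>0 x)"
      by (simp only: u v right_diff_distrib mult.assoc)
    then have "\<bar>of_int (v n) - of_int (u n) * f i\<^sub>0 x\<bar>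
        = ?b ^ (E * k ^ n) * \<bar>poly_real (num n i\<^sub>0) x - poly_real (den n) x * f i\<^sub>0 x\<bar>"
      using b0 by (simp add: abs_mult)
    also have "\<dots> \<le> ?b ^ (E * k ^ n) * (K' * C ^ n * \<bar>x\<bar> ^ (M * k ^ n))"
      using remainder_bound[OF CA KR K0 C0 \<open>i\<^sub>0 < d\<close> xr] b0 by (intro mult_left_mono) auto
    also have "\<dots> \<le> ?b ^ (E * k ^ n) * (?\<beta> / 2 * \<bar>x\<bar> ^ (M * k ^ n))"
      using KC b0 by (intro mult_left_mono mult_right_mono) auto
    \<comment> \<open>Completing to exponent E + 2 uses one power of b^(k^n) already spent on K' C^n
      and borrows a second, which reappears in the denominator.\<close>
    also have "\<dots> = (?b ^ (E + 2) * \<bar>x\<bar> ^ M) ^ k ^ n / (2 * ?\<beta>)"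
      using b0 by (simp add: power_mult_distrib power_mult[symmetric] power_add field_simps
          power2_eq_square)
    also have "\<dots> \<le> 1 / (2 * ?\<beta>)"
      using EM b0 \<beta> by (intro divide_right_mono power_le_one) auto
    finally show "\<bar>of_int (v n) - of_int (u n) * f i\<^sub>0 x\<bar> \<le> 1 / (2 * ?\<beta>)" .
    have "\<bar>of_int (u n)\<bar> = ?b ^ (E * k ^ n) * \<bar>poly_real (den n) x\<bar>"
      using b0 by (simp add: u abs_mult)
    also have "\<dots> \<le> ?b ^ (E * k ^ n) * (?\<beta> / 2)"
      using den_bound[OF CB KQ C0 xr, of n] KC b0 by (intro mult_left_mono) auto
    also have "\<dots> = ?b ^ ((E + 1) * k ^ n) / 2"
      by (simp add: power_add algebra_simps)
    finally show "\<bar>of_int (u n)\<bar> \<le> ?b ^ ((E + 1) * k ^ n) / 2" .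
  next
    fix n :: nat and p q :: int
    assume n: "max n\<^sub>1 n\<^sub>2 \<le> n" and ne: "of_int q * f i\<^sub>0 x \<noteq> of_int p"
    \<comment> \<open>The form q W_i - p W_0; the difference of two indicators also covers the case
      that both indices are 0.\<close>
    let ?v = "\<lambda>i. (if i = i\<^sub>0 then of_int q else 0) - (if i = 0 then of_int p else 0 :: real)"
    have form: "(\<Sum>i<d. ?v i * g i) = of_int q * g i\<^sub>0 - of_int p * g 0" for g
      using \<open>i\<^sub>0 < d\<close>
      by (simp add: left_diff_distrib sum_subtractf if_distrib[of "\<lambda>c. c * _"] cong: if_cong)
    show "\<exists>j<d. q * v (n + j) \<noteq> p * u (n + j)"
    proof (rule ccontr)
      assume "\<not> ?thesis"
      then have eq: "q * v (n + j) = p * u (n + j)" if "j < d" for j using that by blast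
      have "(\<Sum>i<d. ?v i * f i x) = 0"
      proof (rule n2[of n])
        fix j assume "j < d"
        then have "real_of_int (q * v (n + j)) = real_of_int (p * u (n + j))" by (simp only: eq)
        then have "?b ^ (E * k ^ (n + j)) * (of_int q * poly_real (num (n + j) i\<^sub>0) x)
            = ?b ^ (E * k ^ (n + j)) * (of_int p * poly_real (num (n + j) 0) x)"
          by (simp only: of_int_mult u v num0 mult_ac)
        then show "(\<Sum>i<d. ?v i * poly_real (num (n + j) i) x) = 0"
          unfolding form using b0 by simp
      qed (use n in simp)
      then show False unfolding form using ne f0 by simp
    qed
  qed
qed

end

section \<open>Integer power series as real functions\<close>

lemma of_int_fps_nth [simp]: "fps_nth (of_int_fps f) n = of_int (fps_nth f n)"
  by (simp add: of_int_fps_def)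

lemma of_int_fps_mult: "of_int_fps (f * g) = of_int_fps f * of_int_fps g"
  by (intro fps_ext) (simp add: fps_mult_nth)

lemma of_int_fps_sum: "of_int_fps (\<Sum>i\<in>S. f i) = (\<Sum>i\<in>S. of_int_fps (f i))"
  by (intro fps_ext) (simp add: fps_sum_nth)

lemma of_int_fps_diff: "of_int_fps (f - g) = of_int_fps f - of_int_fps g"
  by (intro fps_ext) simp

lemma of_int_fps_of_poly: "of_int_fps (fps_of_poly p) = fps_of_poly (of_int_poly p)"
  by (intro fps_ext) simp

lemma of_int_fps_0 [simp]: "of_int_fps 0 = 0"
  by (intro fps_ext) simp

lemma of_int_fps_1 [simp]: "of_int_fps 1 = 1"
  by (intro fps_ext) simp

lemma of_int_fps_X_power: "of_int_fps (fps_X ^ n) = fps_X ^ n"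
  by (intro fps_ext) simp

lemma of_int_fps_eq_iff:
  "(of_int_fps f :: 'a :: ring_char_0 fps) = of_int_fps g \<longleftrightarrow> f = g"
  by (auto simp: fps_eq_iff)

lemma fps_nth_compose_X_power:
  assumes "k > 0"
  shows "fps_nth (f oo fps_X ^ k) n = (if k dvd n then fps_nth f (n div k) else 0)"
proof -
  have "fps_nth (f oo fps_X ^ k) n = (\<Sum>i=0..n. if n = k * i then fps_nth f i else 0)"
    by (simp add: fps_compose_nth power_mult[symmetric] if_distrib cong: if_cong)
  also have "\<dots> = (\<Sum>i=0..n. if i = n div k then (if k dvd n then fps_nth f i else 0) else 0)"
    using assms by (intro sum.cong) auto
  finally show ?thesis by simp
qed

lemma of_int_fps_compose_X_power:
  "k > 0 \<Longrightarrow> of_int_fps (f oo fps_X ^ k) = of_int_fps f oo fps_X ^ k"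
  by (intro fps_ext) (simp add: fps_nth_compose_X_power)

text \<open>The coefficients vanish off the multiples of k, so the sum is the original one
  reindexed; this gives convergence and value together.\<close>

lemma sums_fps_compose_X_power:
  fixes f :: "real fps"
  assumes "k > 0" and "ereal \<bar>y ^ k\<bar> < fps_conv_radius f"
  shows "(\<lambda>n. fps_nth (f oo fps_X ^ k) n * y ^ n) sums eval_fps f (y ^ k)"
proof -
  have "(\<lambda>n. fps_nth f n * (y ^ k) ^ n) sums eval_fps f (y ^ k)"
    using assms(2) by (intro sums_eval_fps) simp
  also have "(\<lambda>n. fps_nth f n * (y ^ k) ^ n) =
      (\<lambda>n. fps_nth (f oo fps_X ^ k) (k * n) * y ^ (k * n))"
    using assms(1) by (simp add: fps_nth_compose_X_power power_mult)
  finally show ?thesis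
    using assms(1)
    by (subst (asm) sums_mono_reindex) (auto simp: strict_mono_def fps_nth_compose_X_power)
qed

lemma eval_fps_compose_X_power:
  fixes f :: "real fps"
  assumes "k > 0" and "ereal \<bar>y ^ k\<bar> < fps_conv_radius f"
  shows "eval_fps (f oo fps_X ^ k) y = eval_fps f (y ^ k)"
  using sums_fps_compose_X_power[OF assms] by (simp add: eval_fps_def sums_iff)

text \<open>A cheap bound suffices because only points of the unit disc occur, where r^k <=
  r.\<close>

lemma fps_conv_radius_compose_X_power_ge:
  fixes f :: "real fps"
  assumes "k > 0"
  shows "fps_conv_radius (f oo fps_X ^ k) \<ge> min 1 (fps_conv_radius f)"
  unfolding fps_conv_radius_def[of "f oo fps_X ^ k"]
proof (rule conv_radius_geI_ex')
  fix r :: real assume r: "0 < r" "ereal r < min 1 (fps_conv_radius f)"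
  then have "r ^ k \<le> r" using power_decreasing[of 1 k r] assms by simp
  then have "ereal \<bar>r ^ k\<bar> \<le> ereal r" using r by simp
  also have "ereal r < fps_conv_radius f" using r by simp
  finally show "summable (\<lambda>n. fps_nth (f oo fps_X ^ k) n * of_real r ^ n)"
    using sums_fps_compose_X_power[OF assms, of r f] by (simp add: sums_iff)
qed

lemma eval_fps_sum:
  fixes f :: "'i \<Rightarrow> real fps"
  assumes "\<And>i. i \<in> S \<Longrightarrow> ereal \<bar>y\<bar> < fps_conv_radius (f i)"
  shows "eval_fps (\<Sum>i\<in>S. f i) y = (\<Sum>i\<in>S. eval_fps (f i) y)"
proof -
  have "(\<lambda>n. \<Sum>i\<in>S. fps_nth (f i) n * y ^ n) sums (\<Sum>i\<in>S. eval_fps (f i) y)"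
    using assms by (intro sums_sum sums_eval_fps) simp
  then show ?thesis by (simp add: eval_fps_def fps_sum_nth sum_distrib_right sums_iff)
qed

lemma less_fps_conv_radius_mult:
  fixes f g :: "real fps"
  assumes "ereal y < fps_conv_radius f" "ereal y < fps_conv_radius g"
  shows "ereal y < fps_conv_radius (f * g)"
  using assms by (intro order.strict_trans2[OF _ fps_conv_radius_mult]) simp

lemma eval_mahler_equation:
  fixes F :: "nat \<Rightarrow> int fps"
  defines "f \<equiv> \<lambda>j. eval_fps (of_int_fps (F j) :: real fps)"
  assumes sys: "fps_of_poly B * F i = (\<Sum>j<d. fps_of_poly (A i j) * (F j oo fps_X ^ k))"
    and "k > 0" and "i < d" and y: "\<bar>y\<bar> < 1"
    and conv: "\<And>j. j < d \<Longrightarrow> ereal \<bar>y\<bar> < fps_conv_radius (of_int_fps (F j) :: real fps)"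
  shows "poly_real B y * f i y = (\<Sum>j<d. poly_real (A i j) y * f j (y ^ k))"
proof -
  let ?F = "\<lambda>j. of_int_fps (F j) :: real fps"
  have "ereal \<bar>y ^ k\<bar> \<le> ereal \<bar>y\<bar>"
    using power_decreasing[of 1 k "\<bar>y\<bar>"] assms by (simp add: power_abs)
  then have conv_k: "ereal \<bar>y ^ k\<bar> < fps_conv_radius (?F j)" if "j < d" for j
    using conv[OF that] by (rule order.strict_trans1)
  have conv': "ereal \<bar>y\<bar> < fps_conv_radius (?F j oo fps_X ^ k)" if "j < d" for j
    using y conv[OF that]
    by (intro order.strict_trans2[OF _ fps_conv_radius_compose_X_power_ge[OF \<open>k > 0\<close>]]) simp
  have "poly_real B y * f i y = eval_fps (fps_of_poly (of_int_poly B) * ?F i) y"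
    using conv[OF \<open>i < d\<close>] by (subst eval_fps_mult) (auto simp: f_def)
  also have "fps_of_poly (of_int_poly B) * ?F i = of_int_fps (fps_of_poly B * F i)"
    by (simp only: of_int_fps_mult of_int_fps_of_poly)
  also have "\<dots> = (\<Sum>j<d. fps_of_poly (of_int_poly (A i j)) * (?F j oo fps_X ^ k))"
    using \<open>k > 0\<close> unfolding sys
    by (simp add: of_int_fps_sum of_int_fps_mult of_int_fps_of_poly of_int_fps_compose_X_power)
  also have "eval_fps \<dots> y = (\<Sum>j<d. eval_fps (fps_of_poly (of_int_poly (A i j)) * (?F j oo fps_X ^ k)) y)"
    using conv' by (intro eval_fps_sum less_fps_conv_radius_mult) auto
  also have "\<dots> = (\<Sum>j<d. poly_real (A i j) y * f j (y ^ k))"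
    using conv' conv_k \<open>k > 0\<close>
    by (intro sum.cong) (auto simp: eval_fps_mult eval_fps_compose_X_power f_def)
  finally show ?thesis .
qed

text \<open>Dividing the remainder by x^M merely shifts coefficients and keeps the radius of
  convergence; the quotient is continuous on a compact disc, hence bounded by some K.\<close>

lemma eval_remainder_bound:
  fixes F :: "int fps"
  assumes dvd: "fps_X ^ M dvd fps_of_poly P - fps_of_poly Q * F"
    and conv: "ereal r < fps_conv_radius (of_int_fps F :: real fps)" and "r \<ge> 0"
  obtains K where "\<And>y. \<bar>y\<bar> \<le> r \<Longrightarrow>
    \<bar>poly_real P y - poly_real Q y * eval_fps (of_int_fps F) y\<bar> \<le> K * \<bar>y\<bar> ^ M"
proof -
  let ?G = "fps_of_poly (of_int_poly P) - fps_of_poly (of_int_poly Q) * of_int_fps F :: real fps"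
  obtain S where S: "fps_of_poly P - fps_of_poly Q * F = fps_X ^ M * S" using dvd by blast
  let ?S = "of_int_fps S :: real fps"
  have G: "?G = fps_X ^ M * ?S"
    using arg_cong[OF S, of "of_int_fps :: int fps \<Rightarrow> real fps"]
    by (simp only: of_int_fps_mult of_int_fps_diff of_int_fps_of_poly of_int_fps_X_power)
  have "fps_shift M ?G = ?S" unfolding G by (intro fps_ext) (simp add: fps_X_power_mult_nth)
  then have "fps_conv_radius ?S = fps_conv_radius ?G" by (metis fps_conv_radius_shift)
  also have "\<dots> \<ge> fps_conv_radius (of_int_fps F :: real fps)"
    using fps_conv_radius_diff[of "fps_of_poly (of_int_poly P) :: real fps" "fps_of_poly (of_int_poly Q) * of_int_fps F"]
      fps_conv_radius_mult[of "fps_of_poly (of_int_poly Q) :: real fps" "of_int_fps F"]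
    by (auto intro: order_trans)
  finally have convS: "ereal r < fps_conv_radius ?S" using conv by (rule order.strict_trans2[rotated])
  have less: "ereal \<bar>y\<bar> < R" if "\<bar>y\<bar> \<le> r" "ereal r < R" for y R
    using that by (meson ereal_less_eq(3) order.strict_trans1)
  have "continuous_on (cball 0 r) (eval_fps ?S)"
    by (rule continuous_on_subset[OF continuous_on_eval_fps]) (use less[OF _ convS] in auto)
  then have "compact (eval_fps ?S ` cball 0 r)" by (intro compact_continuous_image) auto
  then obtain K where K: "\<And>y. \<bar>y\<bar> \<le> r \<Longrightarrow> \<bar>eval_fps ?S y\<bar> \<le> K"
    using compact_imp_bounded by (fastforce simp: bounded_iff)
  show ?thesis
  proof (rule that[of K])
    fix y assume y: "\<bar>y\<bar> \<le> r"
    have "ereal \<bar>y\<bar> < fps_conv_radius (fps_of_poly (of_int_poly Q) * of_int_fps F :: real fps)"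
      using less[OF y conv] by (intro less_fps_conv_radius_mult) auto
    then have "poly_real P y - poly_real Q y * eval_fps (of_int_fps F) y = eval_fps ?G y"
      using less[OF y conv] by (simp add: eval_fps_diff eval_fps_mult)
    also have "\<dots> = y ^ M * eval_fps ?S y"
      unfolding G using less[OF y convS] by (simp add: eval_fps_mult)
    finally have eq: "poly_real P y - poly_real Q y * eval_fps (of_int_fps F) y = y ^ M * eval_fps ?S y" .
    have "\<bar>y\<bar> ^ M * \<bar>eval_fps ?S y\<bar> \<le> \<bar>y\<bar> ^ M * K"
      using K[OF y] by (intro mult_left_mono) auto
    then show "\<bar>poly_real P y - poly_real Q y * eval_fps (of_int_fps F) y\<bar> \<le> K * \<bar>y\<bar> ^ M"
      unfolding eq by (simp only: abs_mult power_abs mult.commute[of K])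
  qed
qed

section \<open>Descent of the hypotheses from Q((x)) to Z[[x]], and their numerical form\<close>

lemma fps_to_fls_sum: "fps_to_fls (\<Sum>i\<in>S. f i) = (\<Sum>i\<in>S. fps_to_fls (f i))"
  by (induction S rule: infinite_finite_induct) auto

text \<open>After clearing B, both sides are images of integer power series, and the embedding is
  injective.\<close>

lemma mahler_system_fps:
  assumes sys: "mahler_system k d (mahler_matrix d A B) F" and "B \<noteq> 0" and "k > 0" and "i < d"
  shows "fps_of_poly B * F i = (\<Sum>j<d. fps_of_poly (A i j) * (F j oo fps_X ^ k))"
proof -
  let ?r = "\<lambda>p :: int poly. fps_to_fls (fps_of_poly (of_int_poly p :: rat poly))"
  let ?G = "\<lambda>j. zseries_to_fls (F j oo fps_X ^ k)"
  have B: "of_int_poly B \<noteq> (0 :: rat poly)" using \<open>B \<noteq> 0\<close> by simp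
  then have rB: "?r B \<noteq> 0" by (simp add: fps_of_poly_eq_iff[of _ 0, simplified])
  have "zseries_to_fls (F i) = vec_index (vec d (\<lambda>i. zseries_to_fls (F i))) i"
    using \<open>i < d\<close> by simp
  also have "\<dots> = (\<Sum>j<d. ?r (A i j) / ?r B * ?G j)"
    using sys \<open>i < d\<close> B unfolding mahler_system_def
    by (simp add: mahler_matrix_def scalar_prod_def ratfun_to_fls_Fract atLeast0LessThan)
  finally have "?r B * zseries_to_fls (F i) = (\<Sum>j<d. ?r (A i j) * ?G j)"
    using rB by (simp add: sum_distrib_left)
  then have "zseries_to_fls (fps_of_poly B * F i) = zseries_to_fls (\<Sum>j<d. fps_of_poly (A i j) * (F j oo fps_X ^ k))"
    by (simp add: of_int_fps_mult of_int_fps_sum of_int_fps_of_poly fls_times_fps_to_fls fps_to_fls_sum)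
  then show ?thesis by (simp add: of_int_fps_eq_iff)
qed

lemma lin_indep_over_ratfunD:
  assumes "lin_indep_over_ratfun d F" and "(\<Sum>i<d. fps_of_poly (L i) * F i) = 0"
  shows "\<forall>i<d. L i = 0"
proof -
  let ?c = "\<lambda>i. Fract (of_int_poly (L i) :: rat poly) 1"
  have "(\<Sum>i<d. ratfun_to_fls (?c i) * zseries_to_fls (F i)) = zseries_to_fls (\<Sum>i<d. fps_of_poly (L i) * F i)"
    by (simp add: ratfun_to_fls_Fract of_int_fps_mult of_int_fps_sum of_int_fps_of_poly
        fls_times_fps_to_fls fps_to_fls_sum)
  also have "\<dots> = 0" using assms(2) by simp
  finally have "\<forall>i<d. ?c i = 0"
    using spec[OF assms(1)[unfolded lin_indep_over_ratfun_def], of ?c] by (rule rev_mp)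
  then show ?thesis by (simp add: Zero_fract_def eq_fract)
qed

lemma mahler_height_ge:
  "degree B \<le> mahler_height d A B"
  "i < d \<Longrightarrow> j < d \<Longrightarrow> degree (A i j) \<le> mahler_height d A B"
proof -
  have "{degree (A i j) | i j. i < d \<and> j < d} = (\<lambda>(i, j). degree (A i j)) ` ({..<d} \<times> {..<d})"
    by auto
  then have fin: "finite (insert (degree B) {degree (A i j) | i j. i < d \<and> j < d})" by simp
  show "degree B \<le> mahler_height d A B"
    unfolding mahler_height_def using fin by (rule Max_ge) simp
  show "i < d \<Longrightarrow> j < d \<Longrightarrow> degree (A i j) \<le> mahler_height d A B"
    unfolding mahler_height_def using fin by (rule Max_ge) blast
qed

text \<open>The integer inequality through which the upper bound on the ratio of logarithms
  enters.\<close>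

lemma abs_power_less_of_ln_ratio_less:
  fixes a b :: int
  assumes "a \<noteq> 0" and "b \<ge> 2" and "ln \<bar>real_of_int a\<bar> / ln (real_of_int b) < 1 / (real d + 1)"
  shows "\<bar>a\<bar> ^ (d + 1) < b"
proof -
  have "ln (real_of_int b) > 0" using assms(2) by simp
  then have "(real d + 1) * ln \<bar>real_of_int a\<bar> < ln (real_of_int b)"
    using assms(3) by (simp add: field_simps)
  moreover have "ln (\<bar>real_of_int a\<bar> ^ (d + 1)) = (real d + 1) * ln \<bar>real_of_int a\<bar>"
    using assms(1) by (subst ln_realpow) (auto simp: add.commute)
  ultimately have "ln (\<bar>real_of_int a\<bar> ^ (d + 1)) < ln (real_of_int b)" by simp
  then have "\<bar>real_of_int a\<bar> ^ (d + 1) < real_of_int b"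
    using assms(1,2) by (subst (asm) ln_less_cancel_iff) auto
  then have "real_of_int (\<bar>a\<bar> ^ (d + 1)) < real_of_int b" by simp
  then show ?thesis by (simp only: of_int_less_iff)
qed

theorem theorem4p4:
  fixes k d :: nat
    and A :: "nat \<Rightarrow> nat \<Rightarrow> int poly"
    and B :: "int poly"
    and F :: "nat \<Rightarrow> int fps"
    and a b :: int
    and i :: nat
  assumes "k \<ge> 2" and "d \<ge> 2"
    and "poly B 0 \<noteq> 0"
    and "det (mahler_matrix d A B) \<noteq> 0"
    and "F 0 = 1"
    and "lin_indep_over_ratfun d F"
    and "mahler_system k d (mahler_matrix d A B) F"
    and "a \<noteq> 0" and "b \<ge> 2"
    and "0 \<le> ln \<bar>real_of_int a\<bar> / ln (real_of_int b)"
    and "ln \<bar>real_of_int a\<bar> / ln (real_of_int b) < 1 / (real d + 1)"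
    and "\<And>j. j < d \<Longrightarrow>
           ereal \<bar>real_of_int a / real_of_int b\<bar> < fps_conv_radius (of_int_fps (F j) :: real fps)"
    and "\<And>n. poly (map_poly real_of_int B) ((real_of_int a / real_of_int b) ^ (k ^ n)) \<noteq> 0"
    and "i < d"
  shows "irrationality_exponent (eval_fps (of_int_fps (F i)) (real_of_int a / real_of_int b))
           < ereal (4 ^ (mahler_height d A B * d\<^sup>2) * real k ^ (5 * d\<^sup>2))"
proof -
  define H where "H = mahler_height d A B"
  define u where "u = H + 2"
  define N where "N = (d\<^sup>2 - 1) * u"
  define M where "M = d * (d + 1) * u"
  define E where "E = N + H"
  define x where "x = real_of_int a / real_of_int b"
  define f where "f j = eval_fps (of_int_fps (F j) :: real fps)" for j
  have k0: "k > 0" and d0: "d > 0" using \<open>k \<ge> 2\<close> \<open>d \<ge> 2\<close> by auto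
  have B0: "B \<noteq> 0" using \<open>poly B 0 \<noteq> 0\<close> by auto
  have ab: "\<bar>a\<bar> ^ (d + 1) < b"
    using assms(8,9,11) by (rule abs_power_less_of_ln_ratio_less)
  have "\<bar>a\<bar> ^ 1 \<le> \<bar>a\<bar> ^ (d + 1)" using \<open>a \<noteq> 0\<close> by (intro power_increasing) auto
  with ab have "\<bar>a\<bar> < b" by simp
  then have "\<bar>real_of_int a\<bar> < real_of_int b" by linarith
  then have x1: "\<bar>x\<bar> < 1" using \<open>b \<ge> 2\<close> by (simp add: x_def)
  have sys: "fps_of_poly B * F i = (\<Sum>j<d. fps_of_poly (A i j) * (F j oo fps_X ^ k))" if "i < d" for i
    using assms(7) B0 k0 that by (rule mahler_system_fps)
  have conv: "ereal \<bar>x\<bar> < fps_conv_radius (of_int_fps (F j) :: real fps)" if "j < d" for j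
    using assms(12)[OF that] by (simp add: x_def)
  obtain d' where d': "d = Suc d'" using d0 by (cases d) auto
  have N: "N = (d - 1) * (d + 1) * u"
    by (simp add: N_def d' power2_eq_square algebra_simps)
  have u1: "(d + 1) * u \<ge> 1" by (simp add: u_def)
  have NM: "N + (d + 1) * u = M"
    unfolding N M_def by (simp add: d' algebra_simps)
  have EM: "E < M" using mult_le_mono1[of 1 "d + 1" u] by (simp add: NM[symmetric] E_def u_def)
  \<comment> \<open>The identity for which N and M are chosen: |a|^M is at most b^(d u), so b^(E +
    2) |a|^M is at most b^M.\<close>
  have E2: "E + 2 + d * u = M"
    unfolding NM[symmetric] E_def u_def by (simp add: algebra_simps)
  \<comment> \<open>Imposing (d + 1) u - 1 conditions per series reaches order exactly M, since the
    order count starts at N + 1.\<close>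
  obtain Q P where Q: "Q \<noteq> 0" "degree Q \<le> N" and P: "\<And>j. degree (P j) \<le> N"
    and pade: "\<And>j. j < d \<Longrightarrow> fps_X ^ (N + 1 + ((d + 1) * u - 1)) dvd fps_of_poly (P j) - fps_of_poly Q * F j"
  proof (rule pade_approximation[of F d "(d + 1) * u - 1" N])
    show "(d - 1) * ((d + 1) * u - 1) \<le> N"
      unfolding N mult.assoc by (intro mult_le_mono2) simp
  qed (use assms(5) in blast)+
  have "N + 1 + ((d + 1) * u - 1) = M" using NM u1 by linarith
  note pade = pade[unfolded this]
  \<comment> \<open>The radius is |x| itself: the closed disc through x lies strictly inside the
    region of convergence.\<close>
  interpret mahler_values k d A B Q P f "\<bar>x\<bar>"
  proof
    fix i y assume i: "i < d" and y: "\<bar>y\<bar> \<le> \<bar>x\<bar>"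
    show "poly_real B y * f i y = (\<Sum>j<d. poly_real (A i j) y * f j (y ^ k))"
      unfolding f_def
    proof (rule eval_mahler_equation[where A = A and F = F, OF sys[OF i] k0 i])
      fix j assume "j < d"
      with y show "ereal \<bar>y\<bar> < fps_conv_radius (of_int_fps (F j) :: real fps)"
        using conv[of j] by (intro order.strict_trans1[of "ereal \<bar>y\<bar>" "ereal \<bar>x\<bar>"]) simp_all
    qed (use y x1 in linarith)
  qed fact+
  have "\<exists>K. \<forall>y. \<bar>y\<bar> \<le> \<bar>x\<bar> \<longrightarrow> \<bar>poly_real (P i) y - poly_real Q y * f i y\<bar> \<le> K * \<bar>y\<bar> ^ M" if "i < d" for i
    using eval_remainder_bound[OF pade[OF that] conv[OF that]] unfolding f_def by (metis abs_ge_zero)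
  then obtain K where K: "\<And>i y. i < d \<Longrightarrow> \<bar>y\<bar> \<le> \<bar>x\<bar> \<Longrightarrow>
      \<bar>poly_real (P i) y - poly_real Q y * f i y\<bar> \<le> K i * \<bar>y\<bar> ^ M"
    by metis
  have dn: "degree (num n j) \<le> E * k ^ n" if "j < d" for n j
  proof -
    have "degree (num n j) + H \<le> E * k ^ n"
      using P that mahler_height_ge(2)[of _ d _ A B]
      by (intro degree_num_le) (auto simp: E_def H_def)
    then show ?thesis by simp
  qed
  have dd: "degree (den n) \<le> E * k ^ n" for n
  proof -
    have "degree (den n) + H \<le> E * k ^ n"
      using Q(2) mahler_height_ge(1)[of B d A] by (intro degree_den_le) (auto simp: E_def H_def)
    then show ?thesis by simp
  qed
  have "irrationality_exponent (f i x) \<le> ereal (1 + real ((E + 1) * k ^ d))"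
    unfolding x_def
  proof (rule irrationality_exponent_value_le[where M = M and K = "\<Sum>i<d. \<bar>K i\<bar>"])
    show "a \<noteq> 0" "b \<ge> 2" "i < d" by fact+
    show "\<bar>of_int a / of_int b\<bar> \<le> \<bar>x\<bar>" by (simp add: x_def)
    show "poly_real B ((of_int a / of_int b) ^ k ^ m) \<noteq> 0" for m by (rule assms(13))
    show "det (mat d d (\<lambda>(j, i). num j i)) \<noteq> 0"
    proof (rule det_num_neq_0[OF sys pade Q(1)])
      show "degree Q < M" using Q(2) EM by (simp add: E_def)
      show "poly B 0 \<noteq> 0" by fact
      show "\<forall>i<d. L i = 0" if "(\<Sum>i<d. fps_of_poly (L i) * F i) = 0" for L
        using assms(6) that by (rule lin_indep_over_ratfunD)
    qed
    show "\<bar>poly_real (P i) y - poly_real Q y * f i y\<bar> \<le> (\<Sum>i<d. \<bar>K i\<bar>) * \<bar>y\<bar> ^ M"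
      if "i < d" "\<bar>y\<bar> \<le> \<bar>x\<bar>" for i y
    proof -
      have "K i \<le> \<bar>K i\<bar>" by simp
      also have "\<dots> \<le> (\<Sum>i<d. \<bar>K i\<bar>)" using that(1) by (intro member_le_sum) auto
      finally have "K i * \<bar>y\<bar> ^ M \<le> (\<Sum>i<d. \<bar>K i\<bar>) * \<bar>y\<bar> ^ M" by (intro mult_right_mono) auto
      with K[OF that] show ?thesis by linarith
    qed
    show "degree (num n i) \<le> E * k ^ n" if "i < d" for n i using that by (rule dn)
    show "degree (den n) \<le> E * k ^ n" for n by (rule dd)
    show "num n 0 = den n" for n
      using sys pade assms(5) d0 EM dn[OF d0] dd by (rule num_0_eq_den)
    show "f 0 (of_int a / of_int b) = 1" using assms(5) by (simp add: f_def)
    have "real_of_int b ^ (E + 2) * \<bar>real_of_int a\<bar> ^ M \<le> real_of_int b ^ M"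
    proof -
      have "\<bar>real_of_int a\<bar> ^ M = (\<bar>real_of_int a\<bar> ^ (d + 1)) ^ (d * u)"
        by (simp only: power_mult[symmetric] M_def mult_ac)
      also have "\<dots> \<le> real_of_int b ^ (d * u)"
      proof (rule power_mono)
        have "real_of_int (\<bar>a\<bar> ^ (d + 1)) \<le> real_of_int b"
          using ab by (intro of_int_le_iff[THEN iffD2] less_imp_le)
        then show "\<bar>real_of_int a\<bar> ^ (d + 1) \<le> real_of_int b"
          by (simp only: of_int_power of_int_abs)
      qed simp
      finally have "real_of_int b ^ (E + 2) * \<bar>real_of_int a\<bar> ^ M
          \<le> real_of_int b ^ (E + 2) * real_of_int b ^ (d * u)"
        using \<open>b \<ge> 2\<close> by (intro mult_left_mono) auto
      then show ?thesis by (simp only: power_add[symmetric] E2)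
    qed
    then show "real_of_int b ^ (E + 2) * \<bar>of_int a / of_int b\<bar> ^ M \<le> 1"
      using \<open>b \<ge> 2\<close> by (simp add: power_divide field_simps)
  qed
  also have "\<dots> < ereal (4 ^ (H * d\<^sup>2) * real k ^ (5 * d\<^sup>2))"
  proof -
    have "1 + (E + 1) * k ^ d < 4 ^ (H * d\<^sup>2) * k ^ (5 * d\<^sup>2)"
      using mahler_exponent_bound[OF assms(2,1), of H] by (simp only: E_def N_def u_def)
    then have "real (1 + (E + 1) * k ^ d) < real (4 ^ (H * d\<^sup>2) * k ^ (5 * d\<^sup>2))"
      by (simp only: of_nat_less_iff)
    then show ?thesis by simp
  qed
  finally show ?thesis by (simp add: f_def x_def H_def)
qed

end
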